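(* Fix $\mathcal S$, $\mathcal A$, $\mathcal R$, and consider the PTSC and the PTS they determine. (1) If $\Gamma\vdash M:A$ then $\mathcal B(\Gamma)\vdash_{\mathsf{PTS}}\mathcal B(M):\mathcal B(A)$. (2) If $\Gamma;B\vdash l:C$ then $\mathcal B(\Gamma),y:\mathcal B(B)\vdash_{\mathsf{PTS}}\mathcal B^y(l):\mathcal B(C)$ for any fresh variable $y$. (3) If $\Gamma\ \mathsf{wf}$ in the PTSC then $\mathcal B(\Gamma)\ \mathsf{wf}$ in the PTS.
   Context: Ground PTSC syntax: given sorts $\mathcal S$ and variables, terms $M ::= \Pi x^{A}.B \mid \lambda x^{A}.M \mid s \mid x\,l \mid M\,l \mid \langle N/x\rangle_A M$ and lists $l ::= [\,] \mid M\cdot l \mid l @ l' \mid \langle N/x\rangle_A l$ ($\langle N/x\rangle_A$ explicit substitution binding $x$; $\Pi,\lambda$ bind $x$). Reduction $\to$ is the contextual closure of: $(\lambda x^A.M)(N\cdot l)\to(\langle N/x\rangle_A M)\,l$; $M\,[\,]\to M$; $(x\,l)\,l'\to x\,(l@l')$; $(M\,l)\,l'\to M\,(l@l')$; $(M\cdot l')@l\to M\cdot(l'@l)$; $[\,]@l\to l$; $(l@l')@l''\to l@(l'@l'')$; $l@[\,]\to l$; $\langle P/y\rangle_G(\lambda x^A.M)\to\lambda x^{\langle P/y\rangle_G A}.\langle P/y\rangle_G M$; $\langle P/y\rangle_G(y\,l)\to P\,(\langle P/y\rangle_G l)$; $\langle P/y\rangle_G(x\,l)\to x\,(\langle P/y\rangle_G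 l)$ ($x\ne y$); $\langle P/y\rangle_G(M\,l)\to(\langle P/y\rangle_G M)(\langle P/y\rangle_G l)$; $\langle P/y\rangle_G(\Pi x^A.B)\to\Pi x^{\langle P/y\rangle_G A}.\langle P/y\rangle_G B$; $\langle P/y\rangle_G s\to s$; $\langle P/y\rangle_G[\,]\to[\,]$; $\langle P/y\rangle_G(M\cdot l)\to(\langle P/y\rangle_G M)\cdot(\langle P/y\rangle_G l)$; $\langle P/y\rangle_G(l@l')\to(\langle P/y\rangle_G l)@(\langle P/y\rangle_G l')$; $\leftrightarrow^*$ is the induced equivalence. PTSC typing (parameters $\mathcal A\subseteq\mathcal S^2$, $\mathcal R\subseteq\mathcal S^3$): environments are lists of $(x:A)$; $\langle P/x\rangle_A\Delta$ applies the substitution to every type of $\Delta$; $\Gamma\sqsubseteq\Delta$ means each $(x:A)\in\Gamma$ has some $(x:B)\in\Delta$ with $A\leftrightarrow^*B$. Rules: $\emptyset\ \mathsf{wf}$; $\Gamma\vdash A:s$, $x\notin\mathrm{dom}\,\Gamma\Rightarrow\Gamma,(x:A)\ \mathsf{wf}$; $\Gamma\ \mathsf{wf}$, $(s,s')\in\mathcal A\Rightarrow\Gamma\vdash s:s'$; $\Gamma\vdash A:s_1$, $\Gamma,(x:A)\vdash B:s_2$, $(s_1,s_2,s_3)\in\mathcal R\Rightarrow\Gamma\vdash\Pi x^A.B:s_3$; $\Gamma\vdash\Pi x^A.B:s$, $\Gamma,(x:A)\vdash M:B\Rightarrow\Gamma\vdash\lambda x^A.M:\Pi x^A.B$; $\Gamma;A\vdash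 l:B$, $(x:A)\in\Gamma\Rightarrow\Gamma\vdash x\,l:B$; $\Gamma\vdash A:s\Rightarrow\Gamma;A\vdash[\,]:A$; $\Gamma\vdash M:A$, $\Gamma\vdash B:s$, $A\leftrightarrow^*B\Rightarrow\Gamma\vdash M:B$; $\Gamma\vdash\Pi x^A.B:s$, $\Gamma\vdash M:A$, $\Gamma;\langle M/x\rangle_A B\vdash l:C\Rightarrow\Gamma;\Pi x^A.B\vdash M\cdot l:C$; $\Gamma;C\vdash l:A$, $\Gamma\vdash B:s$, $A\leftrightarrow^*B\Rightarrow\Gamma;C\vdash l:B$; $\Gamma;A\vdash l:C$, $\Gamma\vdash B:s$, $A\leftrightarrow^*B\Rightarrow\Gamma;B\vdash l:C$; $\Gamma;C\vdash l':A$, $\Gamma;A\vdash l:B\Rightarrow\Gamma;C\vdash l'@l:B$; $\Gamma\vdash P:A$, $\Gamma,(x:A),\Delta;B\vdash l:C$, $\Gamma,\langle P/x\rangle_A\Delta\sqsubseteq\Delta'$, $\Delta'\ \mathsf{wf}\Rightarrow\Delta';\langle P/x\rangle_A B\vdash\langle P/x\rangle_A l:\langle P/x\rangle_A C$; $\Gamma\vdash M:A$, $\Gamma;A\vdash l:B\Rightarrow\Gamma\vdash M\,l:B$; $\Gamma\vdash P:A$, $\Gamma,(x:A),\Delta\vdash M:C$, $\Gamma,\langle P/x\rangle_A\Delta\sqsubseteq\Delta'$, $\Delta'\ \mathsf{wf}\Rightarrow\Delta'\vdash\langle P/x\rangle_A M:C'$ with $C'=C$ if $C\in\mathcal S$,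 else $C'=\langle P/x\rangle_A C$. PTS: terms $t,u,T,U ::= x\mid s\mid\Pi x^T.t\mid\lambda x^T.t\mid t\,u$, $\beta$-reduction $(\lambda x^v.t)u\to t\{x:=u\}$, $\leftrightarrow_\beta^*$ its equivalence. PTS typing rules (same $\mathcal S,\mathcal A,\mathcal R$): $\emptyset\ \mathsf{wf}$; $\Gamma\vdash_{\mathsf{PTS}}T:s$, $x\notin\mathrm{dom}\,\Gamma\Rightarrow\Gamma,(x:T)\ \mathsf{wf}$; $\Gamma\ \mathsf{wf}$, $(x:T)\in\Gamma\Rightarrow\Gamma\vdash_{\mathsf{PTS}}x:T$; $\Gamma\ \mathsf{wf}$, $(s,s')\in\mathcal A\Rightarrow\Gamma\vdash_{\mathsf{PTS}}s:s'$; $\Gamma\vdash_{\mathsf{PTS}}U:s_1$, $\Gamma,(x:U)\vdash_{\mathsf{PTS}}T:s_2$, $(s_1,s_2,s_3)\in\mathcal R\Rightarrow\Gamma\vdash_{\mathsf{PTS}}\Pi x^U.T:s_3$; $\Gamma\vdash_{\mathsf{PTS}}\Pi x^U.T:s$, $\Gamma,(x:U)\vdash_{\mathsf{PTS}}t:T\Rightarrow\Gamma\vdash_{\mathsf{PTS}}\lambda x^U.t:\Pi x^U.T$; $\Gamma\vdash_{\mathsf{PTS}}t:\Pi x^U.T$, $\Gamma\vdash_{\mathsf{PTS}}u:U\Rightarrow\Gamma\vdash_{\mathsf{PTS}}t\,u:T\{x:=u\}$; $\Gamma\vdash_{\mathsf{PTS}}t:U$, $\Gamma\vdash_{\mathsf{PTS}}V:s$,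 $U\leftrightarrow_\beta^*V\Rightarrow\Gamma\vdash_{\mathsf{PTS}}t:V$. Translation $\mathcal B$ (PTSC to PTS): $\mathcal B(\Pi x^A.B)=\Pi x^{\mathcal B(A)}.\mathcal B(B)$, $\mathcal B(\lambda x^A.M)=\lambda x^{\mathcal B(A)}.\mathcal B(M)$, $\mathcal B(s)=s$, $\mathcal B(x\,l)=\mathcal B^z(l)\{z:=x\}$, $\mathcal B(M\,l)=\mathcal B^z(l)\{z:=\mathcal B(M)\}$ ($z$ fresh), $\mathcal B(\langle P/x\rangle_K M)=\mathcal B(M)\{x:=\mathcal B(P)\}$; $\mathcal B^y([\,])=y$, $\mathcal B^y(M\cdot l)=\mathcal B^z(l)\{z:=y\,\mathcal B(M)\}$, $\mathcal B^y(l@l')=\mathcal B^z(l')\{z:=\mathcal B^y(l)\}$ ($z$ fresh), $\mathcal B^y(\langle P/x\rangle_K l)=\mathcal B^y(l)\{x:=\mathcal B(P)\}$. On environments: $\mathcal B(\emptyset)=\emptyset$, $\mathcal B(\Gamma,(x:A))=\mathcal B(\Gamma),(x:\mathcal B(A))$. *)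

theory Defs
  imports Main
begin

text \<open>
  Variables are natural numbers, and terms are taken up to renaming of bound variables. To make
  equality of the datatypes coincide with alpha-equivalence, the datatypes below bind namelessly:
  under a binder, index \<open>0\<close> is the bound variable and index \<open>Suc n\<close> is the variable called \<open>n\<close>
  outside. In particular, an index that is free in a whole term simply \<^emph>\<open>is\<close> the name of a free
  variable, so every element of the datatypes is a term. Environments are not positional:
  they are lists of pairs of a variable and a type.

  The named binders of the usual presentation are recovered by functions \<open>Pi x A B\<close>, \<open>Lam x A M\<close>,
  \<open>Sub P x A M\<close> etc., which bind the variable \<open>x\<close> by name; all rules are stated through them.
\<close>

definition fresh :: "nat set \<Rightarrow> nat" where
  "fresh X = (SOME z. z \<notin> X)"

text \<open>The action under a binder of a renaming of variables, the renaming that makes room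
  for a new binder for \<open>x\<close>, and the free variables seen from outside a binder.\<close>

definition up :: "(nat \<Rightarrow> nat) \<Rightarrow> nat \<Rightarrow> nat" where
  "up f = case_nat 0 (\<lambda>n. Suc (f n))"

definition bind :: "nat \<Rightarrow> nat \<Rightarrow> nat" where
  "bind x n = (if n = x then 0 else Suc n)"

definition below :: "nat set \<Rightarrow> nat set" where
  "below X = {n. Suc n \<in> X}"

abbreviation edom :: "(nat \<times> 'a) list \<Rightarrow> nat set" where
  "edom \<Gamma> \<equiv> fst ` set \<Gamma>"


section \<open>Terms and lists of PTSC\<close>

text \<open>The elements of \<open>'s\<close> are the sorts. \<open>VApp x l\<close> is $x\,l$, \<open>TApp M l\<close> is $M\,l$, and
  \<open>DSub P A M\<close> and \<open>DLSub P A l\<close> are the explicit substitutions, which bind in their last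
  argument only.\<close>

datatype 's trm =
    DPi "'s trm" "'s trm"
  | DLam "'s trm" "'s trm"
  | Sort 's
  | VApp nat "'s lst"
  | TApp "'s trm" "'s lst"
  | DSub "'s trm" "'s trm" "'s trm"
and 's lst =
    LNil
  | LCons "'s trm" "'s lst"
  | LApp "'s lst" "'s lst"
  | DLSub "'s trm" "'s trm" "'s lst"

primrec ren :: "(nat \<Rightarrow> nat) \<Rightarrow> 's trm \<Rightarrow> 's trm"
  and lren :: "(nat \<Rightarrow> nat) \<Rightarrow> 's lst \<Rightarrow> 's lst" where
  "ren f (DPi A B) = DPi (ren f A) (ren (up f) B)"
| "ren f (DLam A M) = DLam (ren f A) (ren (up f) M)"
| "ren f (Sort s) = Sort s"
| "ren f (VApp x l) = VApp (f x) (lren f l)"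
| "ren f (TApp M l) = TApp (ren f M) (lren f l)"
| "ren f (DSub P A M) = DSub (ren f P) (ren f A) (ren (up f) M)"
| "lren f LNil = LNil"
| "lren f (LCons M l) = LCons (ren f M) (lren f l)"
| "lren f (LApp l l') = LApp (lren f l) (lren f l')"
| "lren f (DLSub P A l) = DLSub (ren f P) (ren f A) (lren (up f) l)"

primrec fv :: "'s trm \<Rightarrow> nat set" and lfv :: "'s lst \<Rightarrow> nat set" where
  "fv (DPi A B) = fv A \<union> below (fv B)"
| "fv (DLam A M) = fv A \<union> below (fv M)"
| "fv (Sort s) = {}"
| "fv (VApp x l) = insert x (lfv l)"
| "fv (TApp M l) = fv M \<union> lfv l"
| "fv (DSub P A M) = fv P \<union> fv A \<union> below (fv M)"
| "lfv LNil = {}"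
| "lfv (LCons M l) = fv M \<union> lfv l"
| "lfv (LApp l l') = lfv l \<union> lfv l'"
| "lfv (DLSub P A l) = fv P \<union> fv A \<union> below (lfv l)"

abbreviation Pi :: "nat \<Rightarrow> 's trm \<Rightarrow> 's trm \<Rightarrow> 's trm" where
  "Pi x A B \<equiv> DPi A (ren (bind x) B)"

abbreviation Lam :: "nat \<Rightarrow> 's trm \<Rightarrow> 's trm \<Rightarrow> 's trm" where
  "Lam x A M \<equiv> DLam A (ren (bind x) M)"

text \<open>\<open>Sub P x A M\<close> is $\langle P/x\rangle_A M$.\<close>

abbreviation Sub :: "'s trm \<Rightarrow> nat \<Rightarrow> 's trm \<Rightarrow> 's trm \<Rightarrow> 's trm" where
  "Sub P x A M \<equiv> DSub P A (ren (bind x) M)"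

abbreviation LSub :: "'s trm \<Rightarrow> nat \<Rightarrow> 's trm \<Rightarrow> 's lst \<Rightarrow> 's lst" where
  "LSub P x A l \<equiv> DLSub P A (lren (bind x) l)"


subsection \<open>Reduction\<close>

text \<open>The side conditions of \<open>sub_Lam\<close> and \<open>sub_Pi\<close> only rule out capture; they can always be met
  by renaming the binder \<open>x\<close>. The names starting with \<open>c_\<close> mark the contextual closure.\<close>

inductive red :: "'s trm \<Rightarrow> 's trm \<Rightarrow> bool" and lred :: "'s lst \<Rightarrow> 's lst \<Rightarrow> bool" where
  beta: "red (TApp (Lam x A M) (LCons N l)) (TApp (Sub N x A M) l)"
| app_nil: "red (TApp M LNil) M"
| var_app: "red (TApp (VApp x l) l') (VApp x (LApp l l'))"
| app_app: "red (TApp (TApp M l) l') (TApp M (LApp l l'))"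
| cons_append: "lred (LApp (LCons M l') l) (LCons M (LApp l' l))"
| nil_append: "lred (LApp LNil l) l"
| append_assoc: "lred (LApp (LApp l l') l'') (LApp l (LApp l' l''))"
| append_nil: "lred (LApp l LNil) l"
| sub_Lam: "x \<noteq> y \<Longrightarrow> x \<notin> fv P \<Longrightarrow> x \<notin> fv G \<Longrightarrow>
    red (Sub P y G (Lam x A M)) (Lam x (Sub P y G A) (Sub P y G M))"
| sub_var_eq: "red (Sub P y G (VApp y l)) (TApp P (LSub P y G l))"
| sub_var_neq: "x \<noteq> y \<Longrightarrow> red (Sub P y G (VApp x l)) (VApp x (LSub P y G l))"
| sub_app: "red (Sub P y G (TApp M l)) (TApp (Sub P y G M) (LSub P y G l))"
| sub_Pi: "x \<noteq> y \<Longrightarrow> x \<notin> fv P \<Longrightarrow> x \<notin> fv G \<Longrightarrow>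
    red (Sub P y G (Pi x A B)) (Pi x (Sub P y G A) (Sub P y G B))"
| sub_Sort: "red (Sub P y G (Sort s)) (Sort s)"
| sub_nil: "lred (LSub P y G LNil) LNil"
| sub_cons: "lred (LSub P y G (LCons M l)) (LCons (Sub P y G M) (LSub P y G l))"
| sub_append: "lred (LSub P y G (LApp l l')) (LApp (LSub P y G l) (LSub P y G l'))"
| c_Pi1: "red A A' \<Longrightarrow> red (Pi x A B) (Pi x A' B)"
| c_Pi2: "red B B' \<Longrightarrow> red (Pi x A B) (Pi x A B')"
| c_Lam1: "red A A' \<Longrightarrow> red (Lam x A M) (Lam x A' M)"
| c_Lam2: "red M M' \<Longrightarrow> red (Lam x A M) (Lam x A M')"
| c_VApp: "lred l l' \<Longrightarrow> red (VApp x l) (VApp x l')"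
| c_TApp1: "red M M' \<Longrightarrow> red (TApp M l) (TApp M' l)"
| c_TApp2: "lred l l' \<Longrightarrow> red (TApp M l) (TApp M l')"
| c_Sub1: "red P P' \<Longrightarrow> red (Sub P x A M) (Sub P' x A M)"
| c_Sub2: "red A A' \<Longrightarrow> red (Sub P x A M) (Sub P x A' M)"
| c_Sub3: "red M M' \<Longrightarrow> red (Sub P x A M) (Sub P x A M')"
| c_LCons1: "red M M' \<Longrightarrow> lred (LCons M l) (LCons M' l)"
| c_LCons2: "lred l l' \<Longrightarrow> lred (LCons M l) (LCons M l')"
| c_LApp1: "lred l1 l1' \<Longrightarrow> lred (LApp l1 l2) (LApp l1' l2)"
| c_LApp2: "lred l2 l2' \<Longrightarrow> lred (LApp l1 l2) (LApp l1 l2')"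
| c_LSub1: "red P P' \<Longrightarrow> lred (LSub P x A l) (LSub P' x A l)"
| c_LSub2: "red A A' \<Longrightarrow> lred (LSub P x A l) (LSub P x A' l)"
| c_LSub3: "lred l l' \<Longrightarrow> lred (LSub P x A l) (LSub P x A l')"

abbreviation conv :: "'s trm \<Rightarrow> 's trm \<Rightarrow> bool" (infix "\<leftrightarrow>\<^sup>*" 50) where
  "M \<leftrightarrow>\<^sup>* N \<equiv> equivclp red M N"


subsection \<open>Environments\<close>

type_synonym 's env = "(nat \<times> 's trm) list"

definition env_sub :: "'s trm \<Rightarrow> nat \<Rightarrow> 's trm \<Rightarrow> 's env \<Rightarrow> 's env" where
  "env_sub P x A \<Delta> = map (\<lambda>(y, B). (y, Sub P x A B)) \<Delta>"

definition env_le :: "'s env \<Rightarrow> 's env \<Rightarrow> bool" (infix "\<sqsubseteq>" 50) where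
  "\<Gamma> \<sqsubseteq> \<Delta> \<longleftrightarrow> (\<forall>(x, A) \<in> set \<Gamma>. \<exists>B. (x, B) \<in> set \<Delta> \<and> A \<leftrightarrow>\<^sup>* B)"


section \<open>Terms of PTS\<close>

datatype 's pterm =
    PVar nat
  | PSort 's
  | DPPi "'s pterm" "'s pterm"
  | DPLam "'s pterm" "'s pterm"
  | PApp "'s pterm" "'s pterm"

primrec pren :: "(nat \<Rightarrow> nat) \<Rightarrow> 's pterm \<Rightarrow> 's pterm" where
  "pren f (PVar x) = PVar (f x)"
| "pren f (PSort s) = PSort s"
| "pren f (DPPi T t) = DPPi (pren f T) (pren (up f) t)"
| "pren f (DPLam T t) = DPLam (pren f T) (pren (up f) t)"
| "pren f (PApp t u) = PApp (pren f t) (pren f u)"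

text \<open>Simultaneous capture-avoiding substitution.\<close>

definition pup :: "(nat \<Rightarrow> 's pterm) \<Rightarrow> nat \<Rightarrow> 's pterm" where
  "pup \<sigma> = case_nat (PVar 0) (\<lambda>n. pren Suc (\<sigma> n))"

primrec psub :: "(nat \<Rightarrow> 's pterm) \<Rightarrow> 's pterm \<Rightarrow> 's pterm" where
  "psub \<sigma> (PVar x) = \<sigma> x"
| "psub \<sigma> (PSort s) = PSort s"
| "psub \<sigma> (DPPi T t) = DPPi (psub \<sigma> T) (psub (pup \<sigma>) t)"
| "psub \<sigma> (DPLam T t) = DPLam (psub \<sigma> T) (psub (pup \<sigma>) t)"
| "psub \<sigma> (PApp t u) = PApp (psub \<sigma> t) (psub \<sigma> u)"

abbreviation subst :: "'s pterm \<Rightarrow> nat \<Rightarrow> 's pterm \<Rightarrow> 's pterm" ("_{_:=_}" [1000, 0, 0] 1000) where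
  "t{x:=u} \<equiv> psub (PVar(x := u)) t"

abbreviation PPi :: "nat \<Rightarrow> 's pterm \<Rightarrow> 's pterm \<Rightarrow> 's pterm" where
  "PPi x T t \<equiv> DPPi T (pren (bind x) t)"

abbreviation PLam :: "nat \<Rightarrow> 's pterm \<Rightarrow> 's pterm \<Rightarrow> 's pterm" where
  "PLam x T t \<equiv> DPLam T (pren (bind x) t)"

inductive bred :: "'s pterm \<Rightarrow> 's pterm \<Rightarrow> bool" where
  pbeta: "bred (PApp (PLam x v t) u) (t{x:=u})"
| pc_Pi1: "bred T T' \<Longrightarrow> bred (PPi x T t) (PPi x T' t)"
| pc_Pi2: "bred t t' \<Longrightarrow> bred (PPi x T t) (PPi x T t')"
| pc_Lam1: "bred T T' \<Longrightarrow> bred (PLam x T t) (PLam x T' t)"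
| pc_Lam2: "bred t t' \<Longrightarrow> bred (PLam x T t) (PLam x T t')"
| pc_App1: "bred t t' \<Longrightarrow> bred (PApp t u) (PApp t' u)"
| pc_App2: "bred u u' \<Longrightarrow> bred (PApp t u) (PApp t u')"

abbreviation pconv :: "'s pterm \<Rightarrow> 's pterm \<Rightarrow> bool" (infix "\<leftrightarrow>\<^sub>\<beta>\<^sup>*" 50) where
  "t \<leftrightarrow>\<^sub>\<beta>\<^sup>* u \<equiv> equivclp bred t u"

type_synonym 's penv = "(nat \<times> 's pterm) list"


section \<open>Typing\<close>

locale pts_spec =
  fixes Ax :: "('s \<times> 's) set"
    and Rl :: "('s \<times> 's \<times> 's) set"
begin

inductive ptsc_wf :: "'s env \<Rightarrow> bool" ("_ wf" [50] 50)
  and ptsc_typ :: "'s env \<Rightarrow> 's trm \<Rightarrow> 's trm \<Rightarrow> bool" ("_ \<turnstile> _ \<^bold>: _" [50, 50, 50] 50)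
  and ptsc_ltyp :: "'s env \<Rightarrow> 's trm \<Rightarrow> 's lst \<Rightarrow> 's trm \<Rightarrow> bool"
    ("_ \<^bold>; _ \<turnstile> _ \<^bold>: _" [50, 50, 50, 50] 50) where
  wf_empty: "[] wf"
| wf_extend: "\<Gamma> \<turnstile> A \<^bold>: Sort s \<Longrightarrow> x \<notin> edom \<Gamma> \<Longrightarrow> (\<Gamma> @ [(x, A)]) wf"
| t_sort: "\<Gamma> wf \<Longrightarrow> (s, s') \<in> Ax \<Longrightarrow> \<Gamma> \<turnstile> Sort s \<^bold>: Sort s'"
| t_Pi: "\<Gamma> \<turnstile> A \<^bold>: Sort s1 \<Longrightarrow> \<Gamma> @ [(x, A)] \<turnstile> B \<^bold>: Sort s2 \<Longrightarrow> (s1, s2, s3) \<in> Rl \<Longrightarrow>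
    \<Gamma> \<turnstile> Pi x A B \<^bold>: Sort s3"
| t_Lam: "\<Gamma> \<turnstile> Pi x A B \<^bold>: Sort s \<Longrightarrow> \<Gamma> @ [(x, A)] \<turnstile> M \<^bold>: B \<Longrightarrow> \<Gamma> \<turnstile> Lam x A M \<^bold>: Pi x A B"
| t_var: "\<Gamma> \<^bold>; A \<turnstile> l \<^bold>: B \<Longrightarrow> (x, A) \<in> set \<Gamma> \<Longrightarrow> \<Gamma> \<turnstile> VApp x l \<^bold>: B"
| t_nil: "\<Gamma> \<turnstile> A \<^bold>: Sort s \<Longrightarrow> \<Gamma> \<^bold>; A \<turnstile> LNil \<^bold>: A"
| t_conv: "\<Gamma> \<turnstile> M \<^bold>: A \<Longrightarrow> \<Gamma> \<turnstile> B \<^bold>: Sort s \<Longrightarrow> A \<leftrightarrow>\<^sup>* B \<Longrightarrow> \<Gamma> \<turnstile> M \<^bold>: B"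
| t_cons: "\<Gamma> \<turnstile> Pi x A B \<^bold>: Sort s \<Longrightarrow> \<Gamma> \<turnstile> M \<^bold>: A \<Longrightarrow> \<Gamma> \<^bold>; Sub M x A B \<turnstile> l \<^bold>: C \<Longrightarrow>
    \<Gamma> \<^bold>; Pi x A B \<turnstile> LCons M l \<^bold>: C"
| t_lconv_right: "\<Gamma> \<^bold>; C \<turnstile> l \<^bold>: A \<Longrightarrow> \<Gamma> \<turnstile> B \<^bold>: Sort s \<Longrightarrow> A \<leftrightarrow>\<^sup>* B \<Longrightarrow> \<Gamma> \<^bold>; C \<turnstile> l \<^bold>: B"
| t_lconv_left: "\<Gamma> \<^bold>; A \<turnstile> l \<^bold>: C \<Longrightarrow> \<Gamma> \<turnstile> B \<^bold>: Sort s \<Longrightarrow> A \<leftrightarrow>\<^sup>* B \<Longrightarrow> \<Gamma> \<^bold>; B \<turnstile> l \<^bold>: C"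
| t_append: "\<Gamma> \<^bold>; C \<turnstile> l' \<^bold>: A \<Longrightarrow> \<Gamma> \<^bold>; A \<turnstile> l \<^bold>: B \<Longrightarrow> \<Gamma> \<^bold>; C \<turnstile> LApp l' l \<^bold>: B"
| t_lsub: "\<Gamma> \<turnstile> P \<^bold>: A \<Longrightarrow> \<Gamma> @ [(x, A)] @ \<Delta> \<^bold>; B \<turnstile> l \<^bold>: C \<Longrightarrow>
    \<Gamma> @ env_sub P x A \<Delta> \<sqsubseteq> \<Delta>' \<Longrightarrow> \<Delta>' wf \<Longrightarrow>
    \<Delta>' \<^bold>; Sub P x A B \<turnstile> LSub P x A l \<^bold>: Sub P x A C"
| t_app: "\<Gamma> \<turnstile> M \<^bold>: A \<Longrightarrow> \<Gamma> \<^bold>; A \<turnstile> l \<^bold>: B \<Longrightarrow> \<Gamma> \<turnstile> TApp M l \<^bold>: B"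
| t_sub: "\<Gamma> \<turnstile> P \<^bold>: A \<Longrightarrow> \<Gamma> @ [(x, A)] @ \<Delta> \<turnstile> M \<^bold>: C \<Longrightarrow>
    \<Gamma> @ env_sub P x A \<Delta> \<sqsubseteq> \<Delta>' \<Longrightarrow> \<Delta>' wf \<Longrightarrow>
    \<Delta>' \<turnstile> Sub P x A M \<^bold>: (if C \<in> range Sort then C else Sub P x A C)"

inductive pts_wf :: "'s penv \<Rightarrow> bool" ("_ wf\<^sub>P\<^sub>T\<^sub>S" [50] 50)
  and pts_typ :: "'s penv \<Rightarrow> 's pterm \<Rightarrow> 's pterm \<Rightarrow> bool"
    ("_ \<turnstile>\<^sub>P\<^sub>T\<^sub>S _ \<^bold>: _" [50, 50, 50] 50) where
  pwf_empty: "[] wf\<^sub>P\<^sub>T\<^sub>S"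
| pwf_extend: "\<Gamma> \<turnstile>\<^sub>P\<^sub>T\<^sub>S T \<^bold>: PSort s \<Longrightarrow> x \<notin> edom \<Gamma> \<Longrightarrow> (\<Gamma> @ [(x, T)]) wf\<^sub>P\<^sub>T\<^sub>S"
| p_var: "\<Gamma> wf\<^sub>P\<^sub>T\<^sub>S \<Longrightarrow> (x, T) \<in> set \<Gamma> \<Longrightarrow> \<Gamma> \<turnstile>\<^sub>P\<^sub>T\<^sub>S PVar x \<^bold>: T"
| p_sort: "\<Gamma> wf\<^sub>P\<^sub>T\<^sub>S \<Longrightarrow> (s, s') \<in> Ax \<Longrightarrow> \<Gamma> \<turnstile>\<^sub>P\<^sub>T\<^sub>S PSort s \<^bold>: PSort s'"
| p_Pi: "\<Gamma> \<turnstile>\<^sub>P\<^sub>T\<^sub>S U \<^bold>: PSort s1 \<Longrightarrow> \<Gamma> @ [(x, U)] \<turnstile>\<^sub>P\<^sub>T\<^sub>S T \<^bold>: PSort s2 \<Longrightarrow> (s1, s2, s3) \<in> Rl \<Longrightarrow>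
    \<Gamma> \<turnstile>\<^sub>P\<^sub>T\<^sub>S PPi x U T \<^bold>: PSort s3"
| p_Lam: "\<Gamma> \<turnstile>\<^sub>P\<^sub>T\<^sub>S PPi x U T \<^bold>: PSort s \<Longrightarrow> \<Gamma> @ [(x, U)] \<turnstile>\<^sub>P\<^sub>T\<^sub>S t \<^bold>: T \<Longrightarrow>
    \<Gamma> \<turnstile>\<^sub>P\<^sub>T\<^sub>S PLam x U t \<^bold>: PPi x U T"
| p_app: "\<Gamma> \<turnstile>\<^sub>P\<^sub>T\<^sub>S t \<^bold>: PPi x U T \<Longrightarrow> \<Gamma> \<turnstile>\<^sub>P\<^sub>T\<^sub>S u \<^bold>: U \<Longrightarrow> \<Gamma> \<turnstile>\<^sub>P\<^sub>T\<^sub>S PApp t u \<^bold>: T{x:=u}"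
| p_conv: "\<Gamma> \<turnstile>\<^sub>P\<^sub>T\<^sub>S t \<^bold>: U \<Longrightarrow> \<Gamma> \<turnstile>\<^sub>P\<^sub>T\<^sub>S V \<^bold>: PSort s \<Longrightarrow> U \<leftrightarrow>\<^sub>\<beta>\<^sup>* V \<Longrightarrow> \<Gamma> \<turnstile>\<^sub>P\<^sub>T\<^sub>S t \<^bold>: V"

end


section \<open>Translation\<close>

text \<open>\<open>\<B>\<^sub>l y l\<close> is $\mathcal B^y(l)$. The clauses for binders work on the nameless representation, where
  \<open>y\<close> is called \<open>Suc y\<close> under a binder and \<open>case_nat u PVar\<close> substitutes \<open>u\<close> for the bound
  variable; the lemmas at the end give them in named form, and show that the choice
  of the fresh variable does not matter.\<close>

primrec \<B> :: "'s trm \<Rightarrow> 's pterm" and \<B>\<^sub>l :: "nat \<Rightarrow> 's lst \<Rightarrow> 's pterm" where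
  "\<B> (DPi A B) = DPPi (\<B> A) (\<B> B)"
| "\<B> (DLam A M) = DPLam (\<B> A) (\<B> M)"
| "\<B> (Sort s) = PSort s"
| "\<B> (VApp x l) = (let z = fresh (insert x (lfv l)) in (\<B>\<^sub>l z l){z:=PVar x})"
| "\<B> (TApp M l) = (let z = fresh (fv M \<union> lfv l) in (\<B>\<^sub>l z l){z:=\<B> M})"
| "\<B> (DSub P K M) = psub (case_nat (\<B> P) PVar) (\<B> M)"
| "\<B>\<^sub>l y LNil = PVar y"
| "\<B>\<^sub>l y (LCons M l) =
    (let z = fresh (insert y (fv M \<union> lfv l)) in (\<B>\<^sub>l z l){z:=PApp (PVar y) (\<B> M)})"
| "\<B>\<^sub>l y (LApp l l') =
    (let z = fresh (insert y (lfv l \<union> lfv l')) in (\<B>\<^sub>l z l'){z:=\<B>\<^sub>l y l})"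
| "\<B>\<^sub>l y (DLSub P K l) = psub (case_nat (\<B> P) PVar) (\<B>\<^sub>l (Suc y) l)"

definition \<B>\<^sub>e :: "'s env \<Rightarrow> 's penv" where
  "\<B>\<^sub>e \<Gamma> = map (\<lambda>(x, A). (x, \<B> A)) \<Gamma>"



section \<open>The named form of the definitions\<close>

lemma up_simps [simp]: "up f 0 = 0" "up f (Suc n) = Suc (f n)"
  by (simp_all add: up_def)

lemma pup_simps [simp]: "pup \<sigma> 0 = PVar 0" "pup \<sigma> (Suc n) = pren Suc (\<sigma> n)"
  by (simp_all add: pup_def)

lemma bind_simps [simp]: "bind x x = 0" "n \<noteq> x \<Longrightarrow> bind x n = Suc n"
  by (simp_all add: bind_def)

lemma below_iff [simp]: "n \<in> below X \<longleftrightarrow> Suc n \<in> X"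
  by (simp add: below_def)

lemma below_up: "below (up f ` X) = f ` below X"
proof -
  have "Suc n \<in> up f ` X \<longleftrightarrow> n \<in> f ` below X" for n
  proof
    assume "Suc n \<in> up f ` X"
    then obtain m where "m \<in> X" "Suc n = up f m" by auto
    then show "n \<in> f ` below X" by (cases m) auto
  next
    assume "n \<in> f ` below X"
    then obtain m where "Suc m \<in> X" "n = f m" by auto
    then show "Suc n \<in> up f ` X" by (intro image_eqI[of _ _ "Suc m"]) simp_all
  qed
  then show ?thesis by auto
qed

lemma below_bind: "below (bind x ` X) = X - {x}"
  by (auto simp: bind_def image_iff split: if_splits)

lemma finite_below: "finite X \<Longrightarrow> finite (below X)"
  unfolding below_def by (rule finite_vimageI[where h = Suc, unfolded vimage_def]) auto

lemma
  fixes M :: "'s trm" and l :: "'s lst"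
  shows finite_fv: "finite (fv M)" and finite_lfv: "finite (lfv l)"
  by (induction M and l rule: trm.induct lst.induct) (simp_all add: finite_below)

lemma fresh_notin: "finite X \<Longrightarrow> fresh X \<notin> X"
  unfolding fresh_def by (rule someI_ex) (simp add: ex_new_if_finite infinite_UNIV_nat)

lemma
  fixes M :: "'s trm" and l :: "'s lst"
  shows fv_ren: "fv (ren f M) = f ` fv M" and lfv_lren: "lfv (lren f l) = f ` lfv l"
  by (induction M and l arbitrary: f and f rule: trm.induct lst.induct) (auto simp: below_up image_Un)

lemma fv_named:
  "fv (Pi x A B) = fv A \<union> (fv B - {x})"
  "fv (Lam x A M) = fv A \<union> (fv M - {x})"
  "fv (Sub P x A M) = fv P \<union> fv A \<union> (fv M - {x})"
  "lfv (LSub P x A l) = fv P \<union> fv A \<union> (lfv l - {x})"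
  by (auto simp: fv_ren lfv_lren below_bind)

lemma up_comp: "up f (up g n) = up (\<lambda>n. f (g n)) n"
  by (cases n) auto

lemma
  fixes M :: "'s trm" and l :: "'s lst"
  shows ren_ren: "ren f (ren g M) = ren (\<lambda>n. f (g n)) M"
  and lren_lren: "lren f (lren g l) = lren (\<lambda>n. f (g n)) l"
  by (induction M and l arbitrary: f g and f g rule: trm.induct lst.induct) (simp_all add: up_comp)

lemma
  fixes M :: "'s trm" and l :: "'s lst"
  shows ren_cong: "(\<And>n. n \<in> fv M \<Longrightarrow> f n = g n) \<Longrightarrow> ren f M = ren g M"
  and lren_cong: "(\<And>n. n \<in> lfv l \<Longrightarrow> f n = g n) \<Longrightarrow> lren f l = lren g l"
proof (induction M and l arbitrary: f g and f g rule: trm.induct lst.induct)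
  case (DPi A B)
  have "ren f A = ren g A" using DPi.prems by (intro DPi.IH(1)) simp
  moreover have "ren (up f) B = ren (up g) B"
  proof (rule DPi.IH(2))
    show "up f n = up g n" if "n \<in> fv B" for n
      using that DPi.prems by (cases n) simp_all
  qed
  ultimately show ?case by simp
next
  case (DLam A M)
  have "ren f A = ren g A" using DLam.prems by (intro DLam.IH(1)) simp
  moreover have "ren (up f) M = ren (up g) M"
  proof (rule DLam.IH(2))
    show "up f n = up g n" if "n \<in> fv M" for n
      using that DLam.prems by (cases n) simp_all
  qed
  ultimately show ?case by simp
next
  case (DSub P A M)
  have "ren f P = ren g P" using DSub.prems by (intro DSub.IH(1)) simp
  moreover have "ren f A = ren g A" using DSub.prems by (intro DSub.IH(2)) simp
  moreover have "ren (up f) M = ren (up g) M"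
  proof (rule DSub.IH(3))
    show "up f n = up g n" if "n \<in> fv M" for n
      using that DSub.prems by (cases n) simp_all
  qed
  ultimately show ?case by simp
next
  case (DLSub P A l)
  have "ren f P = ren g P" using DLSub.prems by (intro DLSub.IH(1)) simp
  moreover have "ren f A = ren g A" using DLSub.prems by (intro DLSub.IH(2)) simp
  moreover have "lren (up f) l = lren (up g) l"
  proof (rule DLSub.IH(3))
    show "up f n = up g n" if "n \<in> lfv l" for n
      using that DLSub.prems by (cases n) simp_all
  qed
  ultimately show ?case by simp
next
  case (VApp x l)
  have "lren f l = lren g l" using VApp.prems by (intro VApp.IH) simp
  then show ?case using VApp.prems[of x] by simp
next
  case (TApp M l)
  have "ren f M = ren g M" using TApp.prems by (intro TApp.IH(1)) simp
  moreover have "lren f l = lren g l" using TApp.prems by (intro TApp.IH(2)) simp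
  ultimately show ?case by simp
next
  case (LCons M l)
  have "ren f M = ren g M" using LCons.prems by (intro LCons.IH(1)) simp
  moreover have "lren f l = lren g l" using LCons.prems by (intro LCons.IH(2)) simp
  ultimately show ?case by simp
next
  case (LApp l l')
  have "lren f l = lren g l" using LApp.prems by (intro LApp.IH(1)) simp
  moreover have "lren f l' = lren g l'" using LApp.prems by (intro LApp.IH(2)) simp
  ultimately show ?case by simp
qed simp_all

text \<open>Alpha-conversion, and every binder can be given any fresh name.\<close>

lemma ren_bind_alpha:
  "y \<notin> fv M - {x} \<Longrightarrow> ren (bind x) M = ren (bind y) (ren (id(x := y)) M)"
  unfolding ren_ren by (rule ren_cong) (auto simp: bind_def)

lemma lren_bind_alpha:
  "y \<notin> lfv l - {x} \<Longrightarrow> lren (bind x) l = lren (bind y) (lren (id(x := y)) l)"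
  unfolding lren_lren by (rule lren_cong) (auto simp: bind_def)

lemma
  fixes M :: "'s trm" and l :: "'s lst"
  shows ren_id: "ren (\<lambda>n. n) M = M" and lren_id: "lren (\<lambda>n. n) l = l"
proof -
  have "up (\<lambda>n. n) = (\<lambda>n. n)"
  proof
    fix n show "up (\<lambda>n. n) n = n" by (cases n) auto
  qed
  then show "ren (\<lambda>n. n) M = M" "lren (\<lambda>n. n) l = l"
    by (induction M and l rule: trm.induct lst.induct) simp_all
qed

lemma bind_exhaust:
  assumes "x \<notin> below (fv M)"
  obtains M' where "M = ren (bind x) M'"
proof
  have "ren (\<lambda>n. bind x (case_nat x (\<lambda>n. n) n)) M = ren (\<lambda>n. n) M"
    using assms by (intro ren_cong) (auto simp: bind_def split: nat.splits)
  then show "M = ren (bind x) (ren (case_nat x (\<lambda>n. n)) M)"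
    by (simp add: ren_ren ren_id)
qed

lemma lbind_exhaust:
  assumes "x \<notin> below (lfv l)"
  obtains l' where "l = lren (bind x) l'"
proof
  have "lren (\<lambda>n. bind x (case_nat x (\<lambda>n. n) n)) l = lren (\<lambda>n. n) l"
    using assms by (intro lren_cong) (auto simp: bind_def split: nat.splits)
  then show "l = lren (bind x) (lren (case_nat x (\<lambda>n. n)) l)"
    by (simp add: lren_lren lren_id)
qed

primrec pfv :: "'s pterm \<Rightarrow> nat set" where
  "pfv (PVar x) = {x}"
| "pfv (PSort s) = {}"
| "pfv (DPPi T t) = pfv T \<union> below (pfv t)"
| "pfv (DPLam T t) = pfv T \<union> below (pfv t)"
| "pfv (PApp t u) = pfv t \<union> pfv u"

lemma pfv_pren: "pfv (pren f t) = f ` pfv t"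
  by (induction t arbitrary: f) (auto simp: below_up image_Un)

lemma pren_pren: "pren f (pren g t) = pren (\<lambda>n. f (g n)) t"
  by (induction t arbitrary: f g) (simp_all add: up_comp)

lemma pren_psub: "pren f (psub \<sigma> t) = psub (\<lambda>n. pren f (\<sigma> n)) t"
proof (induction t arbitrary: f \<sigma>)
  case (DPPi T t)
  have "(\<lambda>n. pren (up f) (pup \<sigma> n)) = pup (\<lambda>n. pren f (\<sigma> n))"
    by (rule ext) (simp add: pup_def pren_pren split: nat.split)
  then show ?case by (simp add: DPPi)
next
  case (DPLam T t)
  have "(\<lambda>n. pren (up f) (pup \<sigma> n)) = pup (\<lambda>n. pren f (\<sigma> n))"
    by (rule ext) (simp add: pup_def pren_pren split: nat.split)
  then show ?case by (simp add: DPLam)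
qed simp_all

lemma psub_pren: "psub \<sigma> (pren f t) = psub (\<lambda>n. \<sigma> (f n)) t"
proof (induction t arbitrary: f \<sigma>)
  case (DPPi T t)
  have "(\<lambda>n. pup \<sigma> (up f n)) = pup (\<lambda>n. \<sigma> (f n))"
    by (rule ext) (simp add: pup_def up_def split: nat.split)
  then show ?case by (simp add: DPPi)
next
  case (DPLam T t)
  have "(\<lambda>n. pup \<sigma> (up f n)) = pup (\<lambda>n. \<sigma> (f n))"
    by (rule ext) (simp add: pup_def up_def split: nat.split)
  then show ?case by (simp add: DPLam)
qed simp_all

lemma psub_cong: "(\<And>n. n \<in> pfv t \<Longrightarrow> \<sigma> n = \<tau> n) \<Longrightarrow> psub \<sigma> t = psub \<tau> t"
proof (induction t arbitrary: \<sigma> \<tau>)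
  case (DPPi T t)
  have "psub \<sigma> T = psub \<tau> T" using DPPi.prems by (intro DPPi.IH(1)) simp
  moreover have "psub (pup \<sigma>) t = psub (pup \<tau>) t"
  proof (rule DPPi.IH(2))
    show "pup \<sigma> n = pup \<tau> n" if "n \<in> pfv t" for n
      using that DPPi.prems by (cases n) simp_all
  qed
  ultimately show ?case by simp
next
  case (DPLam T t)
  have "psub \<sigma> T = psub \<tau> T" using DPLam.prems by (intro DPLam.IH(1)) simp
  moreover have "psub (pup \<sigma>) t = psub (pup \<tau>) t"
  proof (rule DPLam.IH(2))
    show "pup \<sigma> n = pup \<tau> n" if "n \<in> pfv t" for n
      using that DPLam.prems by (cases n) simp_all
  qed
  ultimately show ?case by simp
next
  case (PApp t u)
  have "psub \<sigma> t = psub \<tau> t" using PApp.prems by (intro PApp.IH(1)) simp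
  moreover have "psub \<sigma> u = psub \<tau> u" using PApp.prems by (intro PApp.IH(2)) simp
  ultimately show ?case by simp
qed simp_all

lemma pup_PVar: "pup (\<lambda>n. PVar (f n)) = (\<lambda>n. PVar (up f n))"
  by (rule ext) (simp add: pup_def up_def split: nat.split)

lemma pren_eq_psub: "pren f t = psub (\<lambda>n. PVar (f n)) t"
  by (induction t arbitrary: f) (simp_all add: pup_PVar)

lemma pfv_psub: "pfv (psub \<sigma> t) \<subseteq> (\<Union>n \<in> pfv t. pfv (\<sigma> n))"
proof (induction t arbitrary: \<sigma>)
  case (DPPi T t)
  have "below (pfv (psub (pup \<sigma>) t)) \<subseteq> (\<Union>n \<in> below (pfv t). pfv (\<sigma> n))"
  proof
    fix m assume "m \<in> below (pfv (psub (pup \<sigma>) t))"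
    then obtain k where "k \<in> pfv t" "Suc m \<in> pfv (pup \<sigma> k)" using DPPi.IH(2)[of "pup \<sigma>"] by auto
    then show "m \<in> (\<Union>n \<in> below (pfv t). pfv (\<sigma> n))" by (cases k) (auto simp: pfv_pren)
  qed
  then show ?case using DPPi.IH(1)[of \<sigma>] by auto
next
  case (DPLam T t)
  have "below (pfv (psub (pup \<sigma>) t)) \<subseteq> (\<Union>n \<in> below (pfv t). pfv (\<sigma> n))"
  proof
    fix m assume "m \<in> below (pfv (psub (pup \<sigma>) t))"
    then obtain k where "k \<in> pfv t" "Suc m \<in> pfv (pup \<sigma> k)" using DPLam.IH(2)[of "pup \<sigma>"] by auto
    then show "m \<in> (\<Union>n \<in> below (pfv t). pfv (\<sigma> n))" by (cases k) (auto simp: pfv_pren)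
  qed
  then show ?case using DPLam.IH(1)[of \<sigma>] by auto
next
  case (PApp t u)
  show ?case using PApp.IH(1)[of \<sigma>] PApp.IH(2)[of \<sigma>] by (simp, blast)
qed simp_all

lemma subst_named:
  "(PVar y){y:=u} = u"
  "x \<noteq> y \<Longrightarrow> (PVar x){y:=u} = PVar x"
  "(PSort s){y:=u} = PSort s"
  "(PApp t t'){y:=u} = PApp (t{y:=u}) (t'{y:=u})"
  "x \<noteq> y \<Longrightarrow> x \<notin> pfv u \<Longrightarrow> (PPi x T t){y:=u} = PPi x (T{y:=u}) (t{y:=u})"
  "x \<noteq> y \<Longrightarrow> x \<notin> pfv u \<Longrightarrow> (PLam x T t){y:=u} = PLam x (T{y:=u}) (t{y:=u})"
proof -
  assume *: "x \<noteq> y" "x \<notin> pfv u"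
  have "pren (bind x) u = pren Suc u"
    using * unfolding pren_eq_psub by (intro psub_cong) (auto simp: bind_def)
  with * have "(\<lambda>n. pup (PVar(y := u)) (bind x n)) = (\<lambda>n. pren (bind x) ((PVar(y := u)) n))"
    by (intro ext) (auto simp: bind_def)
  then have "psub (pup (PVar(y := u))) (pren (bind x) t) = pren (bind x) (t{y:=u})"
    by (simp add: psub_pren pren_psub)
  then show "(PPi x T t){y:=u} = PPi x (T{y:=u}) (t{y:=u})"
    and "(PLam x T t){y:=u} = PLam x (T{y:=u}) (t{y:=u})"
    by simp_all
qed simp_all

lemma pfv_subst: "pfv (t{z:=u}) \<subseteq> (pfv t - {z}) \<union> pfv u"
  using pfv_psub[of "PVar(z := u)" t] by (auto split: if_splits)

lemma pfv_subst_lst: "pfv t \<subseteq> insert z X \<Longrightarrow> pfv (t{z:=u}) \<subseteq> X \<union> pfv u"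
  using pfv_subst[of z u t] by blast

lemma below_pfv_inst: "pfv (psub (case_nat u PVar) t) \<subseteq> pfv u \<union> below (pfv t)"
  using pfv_psub[of "case_nat u PVar" t] by (fastforce split: nat.splits)

lemma
  fixes M :: "'s trm" and l :: "'s lst"
  shows pfv_\<B>: "pfv (\<B> M) \<subseteq> fv M" and pfv_\<B>\<^sub>l: "pfv (\<B>\<^sub>l y l) \<subseteq> insert y (lfv l)"
proof (induction M and l arbitrary: and y rule: trm.induct lst.induct)
  case (VApp x l)
  show ?case using pfv_subst_lst[OF VApp.IH] by (fastforce simp: Let_def)
next
  case (TApp M l)
  show ?case using pfv_subst_lst[OF TApp.IH(2)] TApp.IH(1) by (fastforce simp: Let_def)
next
  case (LCons M l)
  show ?case using pfv_subst_lst[OF LCons.IH(2)] LCons.IH(1) by (fastforce simp: Let_def)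
next
  case (LApp l l')
  show ?case using pfv_subst_lst[OF LApp.IH(2)] LApp.IH(1)[of y] by (fastforce simp: Let_def)
next
  case (DSub P A M)
  show ?case using DSub.IH below_pfv_inst by fastforce
next
  case (DLSub P A l)
  show ?case using DLSub.IH(1) DLSub.IH(3)[of "Suc y"] below_pfv_inst by fastforce
qed auto

text \<open>Renaming \<open>z\<close> to \<open>z'\<close> by \<open>g = f(z := z')\<close> mediates between the two fresh variables.\<close>

lemma pren_subst_fresh:
  assumes "pren (f(z := z')) (\<B>\<^sub>l z l) = \<B>\<^sub>l z' (lren (f(z := z')) l)"
    and "z \<notin> lfv l" and "z' \<notin> f ` lfv l"
  shows "pren f ((\<B>\<^sub>l z l){z:=u}) = (\<B>\<^sub>l z' (lren f l)){z':=pren f u}"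
proof -
  have "lren (f(z := z')) l = lren f l"
    using assms(2) by (intro lren_cong) auto
  then have "(\<B>\<^sub>l z' (lren f l)){z':=pren f u}
      = (pren (f(z := z')) (\<B>\<^sub>l z l)){z':=pren f u}"
    unfolding assms(1) by (simp only:)
  also have "\<dots> = psub (\<lambda>n. pren f ((PVar(z := u)) n)) (\<B>\<^sub>l z l)"
  proof (unfold psub_pren, rule psub_cong)
    fix n assume "n \<in> pfv (\<B>\<^sub>l z l)"
    then have "n = z \<or> f n \<noteq> z'" using assms(3) pfv_\<B>\<^sub>l[of z l] by blast
    then show "(PVar(z' := pren f u)) ((f(z := z')) n) = pren f ((PVar(z := u)) n)"
      by (cases "n = z") simp_all
  qed
  finally show ?thesis unfolding pren_psub ..
qed

lemma fresh_lren: "finite X \<Longrightarrow> lfv l \<subseteq> X \<Longrightarrow> fresh X \<notin> lfv l"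
  by (meson fresh_notin subsetD)

lemma inst_ren: "pren f (psub (case_nat u PVar) t) = psub (case_nat (pren f u) PVar) (pren (up f) t)"
  unfolding pren_psub psub_pren by (rule psub_cong) (simp split: nat.split)

lemma
  fixes M :: "'s trm" and l :: "'s lst"
  shows \<B>_ren: "\<B> (ren f M) = pren f (\<B> M)"
  and \<B>\<^sub>l_ren: "\<B>\<^sub>l (f y) (lren f l) = pren f (\<B>\<^sub>l y l)"
proof (induction M and l arbitrary: f and f y rule: trm.induct lst.induct)
  case (VApp x l)
  let ?z = "fresh (insert x (lfv l))" and ?z' = "fresh (insert (f x) (lfv (lren f l)))"
  have "?z \<notin> lfv l" "?z' \<notin> f ` lfv l"
    unfolding lfv_lren[symmetric] by (rule fresh_lren; auto simp: finite_lfv)+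
  then have "pren f ((\<B>\<^sub>l ?z l){?z:=PVar x}) = (\<B>\<^sub>l ?z' (lren f l)){?z':=pren f (PVar x)}"
    using VApp.IH[of "f(?z := ?z')" ?z] by (intro pren_subst_fresh) (simp_all only: fun_upd_same not_False_eq_True)
  then show ?case
    by (simp only: ren.simps lren.simps \<B>.simps \<B>\<^sub>l.simps Let_def pren.simps)
next
  case (TApp M l)
  let ?z = "fresh (fv M \<union> lfv l)" and ?z' = "fresh (fv (ren f M) \<union> lfv (lren f l))"
  have "?z \<notin> lfv l" "?z' \<notin> f ` lfv l"
    unfolding lfv_lren[symmetric] by (rule fresh_lren; auto simp: finite_fv finite_lfv)+
  then have "pren f ((\<B>\<^sub>l ?z l){?z:=\<B> M}) = (\<B>\<^sub>l ?z' (lren f l)){?z':=pren f (\<B> M)}"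
    using TApp.IH(2)[of "f(?z := ?z')" ?z] by (intro pren_subst_fresh) (simp_all only: fun_upd_same not_False_eq_True)
  then show ?case
    by (simp only: ren.simps lren.simps \<B>.simps \<B>\<^sub>l.simps Let_def pren.simps TApp.IH(1))
next
  case (LCons M l)
  let ?z = "fresh (insert y (fv M \<union> lfv l))"
    and ?z' = "fresh (insert (f y) (fv (ren f M) \<union> lfv (lren f l)))"
  have "?z \<notin> lfv l" "?z' \<notin> f ` lfv l"
    unfolding lfv_lren[symmetric] by (rule fresh_lren; auto simp: finite_fv finite_lfv)+
  then have "pren f ((\<B>\<^sub>l ?z l){?z:=PApp (PVar y) (\<B> M)}) = (\<B>\<^sub>l ?z' (lren f l)){?z':=pren f (PApp (PVar y) (\<B> M))}"
    using LCons.IH(2)[of "f(?z := ?z')" ?z] by (intro pren_subst_fresh) (simp_all only: fun_upd_same not_False_eq_True)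
  then show ?case
    by (simp only: ren.simps lren.simps \<B>.simps \<B>\<^sub>l.simps Let_def pren.simps LCons.IH(1))
next
  case (LApp l l')
  let ?z = "fresh (insert y (lfv l \<union> lfv l'))"
    and ?z' = "fresh (insert (f y) (lfv (lren f l) \<union> lfv (lren f l')))"
  have "?z \<notin> lfv l'" "?z' \<notin> f ` lfv l'"
    unfolding lfv_lren[symmetric] by (rule fresh_lren; auto simp: finite_fv finite_lfv)+
  then have "pren f ((\<B>\<^sub>l ?z l'){?z:=\<B>\<^sub>l y l}) = (\<B>\<^sub>l ?z' (lren f l')){?z':=pren f (\<B>\<^sub>l y l)}"
    using LApp.IH(2)[of "f(?z := ?z')" ?z] by (intro pren_subst_fresh) (simp_all only: fun_upd_same not_False_eq_True)
  then show ?case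
    by (simp only: ren.simps lren.simps \<B>.simps \<B>\<^sub>l.simps Let_def pren.simps LApp.IH(1))
next
  case (DSub P A M)
  then show ?case by (simp add: inst_ren)
next
  case (DLSub P A l)
  show ?case using DLSub.IH(3)[of "up f" "Suc y"] by (simp add: inst_ren DLSub.IH(1))
qed simp_all

lemma subst_fresh_indep:
  assumes "z \<notin> lfv l" and "z' \<notin> lfv l"
  shows "(\<B>\<^sub>l z l){z:=u} = (\<B>\<^sub>l z' l){z':=u}"
proof -
  have id: "pren (\<lambda>n. n) t = t" for t :: "'a pterm"
  proof (induction t)
    have "up (\<lambda>n. n) = (\<lambda>n. n)" by (rule ext) (simp add: up_def split: nat.split)
    then show "\<And>T t. pren (\<lambda>n. n) T = T \<Longrightarrow> pren (\<lambda>n. n) t = t \<Longrightarrow>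
        pren (\<lambda>n. n) (DPPi T t) = DPPi T (t :: 'a pterm)"
      and "\<And>T t. pren (\<lambda>n. n) T = T \<Longrightarrow> pren (\<lambda>n. n) t = t \<Longrightarrow>
        pren (\<lambda>n. n) (DPLam T t) = DPLam T (t :: 'a pterm)"
      by simp_all
  qed simp_all
  have "pren ((\<lambda>n. n)(z := z')) (\<B>\<^sub>l z l) = \<B>\<^sub>l z' (lren ((\<lambda>n. n)(z := z')) l)"
    using \<B>\<^sub>l_ren[of "(\<lambda>n. n)(z := z')" z l] by simp
  from pren_subst_fresh[OF this] assms show ?thesis by (simp add: id lren_id)
qed

lemma inst_bind: "psub (case_nat u PVar) (pren (bind x) t) = t{x:=u}"
  unfolding psub_pren by (rule psub_cong) (auto simp: bind_def)

lemma \<B>_named: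
  "\<B> (Pi x A B) = PPi x (\<B> A) (\<B> B)"
  "\<B> (Lam x A M) = PLam x (\<B> A) (\<B> M)"
  "z \<notin> lfv l \<Longrightarrow> \<B> (VApp x l) = (\<B>\<^sub>l z l){z:=PVar x}"
  "z \<notin> lfv l \<Longrightarrow> \<B> (TApp M l) = (\<B>\<^sub>l z l){z:=\<B> M}"
  "\<B> (Sub P x K M) = (\<B> M){x:=\<B> P}"
  by (simp_all add: \<B>_ren inst_bind Let_def,
      (rule subst_fresh_indep, rule fresh_lren; auto simp: finite_fv finite_lfv)+)

lemma \<B>\<^sub>l_named:
  "\<B>\<^sub>l y LNil = PVar y"
  "z \<notin> lfv l \<Longrightarrow> \<B>\<^sub>l y (LCons M l) = (\<B>\<^sub>l z l){z:=PApp (PVar y) (\<B> M)}"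
  "z \<notin> lfv l' \<Longrightarrow> \<B>\<^sub>l y (LApp l l') = (\<B>\<^sub>l z l'){z:=\<B>\<^sub>l y l}"
  "x \<noteq> y \<Longrightarrow> \<B>\<^sub>l y (LSub P x K l) = (\<B>\<^sub>l y l){x:=\<B> P}"
proof -
  assume "x \<noteq> y"
  then show "\<B>\<^sub>l y (LSub P x K l) = (\<B>\<^sub>l y l){x:=\<B> P}"
    using \<B>\<^sub>l_ren[of "bind x" y l] by (simp add: inst_bind)
qed (simp_all add: Let_def,
    (rule subst_fresh_indep, rule fresh_lren; auto simp: finite_fv finite_lfv)+)

end

theory Submission
  imports Defs
begin

text \<open>
  Typing derivations are translated rule by rule. Reduction steps of PTSC become beta conversions,
  because the translation executes all explicit substitutions and only \<open>beta\<close> creates a redex.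
  A list corresponds to a derivation in an environment extended by a fresh hole; cut rules are
  answered by PTS substitution into that hole. In the substitution rules the side condition
  \<open>\<Gamma>, \<langle>P/x\<rangle>\<Delta> \<sqsubseteq> \<Delta>'\<close> relates environments only up to conversion, so what is needed is a PTS
  substitution lemma in which the substituted terms have the expected types up to conversion.
\<close>


section \<open>Simultaneous substitution\<close>

lemma pup_psub: "psub (pup \<tau>) (pup \<sigma> n) = pup (\<lambda>n. psub \<tau> (\<sigma> n)) n"
  by (cases n) (simp_all add: psub_pren pren_psub)

lemma psub_psub: "psub \<tau> (psub \<sigma> t) = psub (\<lambda>n. psub \<tau> (\<sigma> n)) t"
proof -
  have "(\<lambda>n. psub (pup \<tau>) (pup \<sigma> n)) = pup (\<lambda>n. psub \<tau> (\<sigma> n))" for \<tau> \<sigma> :: "nat \<Rightarrow> 'a pterm"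
    by (rule ext) (rule pup_psub)
  then show ?thesis by (induction t arbitrary: \<sigma> \<tau>) simp_all
qed

lemma psub_PVar [simp]: "psub PVar t = t"
proof -
  have "pup PVar = (PVar :: nat \<Rightarrow> 'a pterm)"
    by (rule ext) (simp add: pup_def split: nat.split)
  then show ?thesis by (induction t) simp_all
qed

lemma psub_ident: "(\<And>n. n \<in> pfv t \<Longrightarrow> \<sigma> n = PVar n) \<Longrightarrow> psub \<sigma> t = t"
  using psub_cong[of t \<sigma> PVar] by simp

lemma subst_notin: "x \<notin> pfv t \<Longrightarrow> t{x:=u} = t"
  by (rule psub_ident) auto

text \<open>Instantiating index 0 cancels the shift in \<open>pup\<close>, so a substitution can be
  moved past it. This gives closure of nameless beta under substitution and is reused for
  \<open>appl\<close> and for PTS application.\<close>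

lemma psub_inst: "psub \<sigma> (psub (case_nat u PVar) t) = psub (case_nat (psub \<sigma> u) PVar) (psub (pup \<sigma>) t)"
  unfolding psub_psub by (rule psub_cong) (simp add: psub_pren split: nat.split)

lemma inst_shift [simp]: "psub (case_nat u PVar) (pren Suc t) = t"
  by (simp add: psub_pren)

lemma finite_pfv: "finite (pfv t)"
  by (induction t) (simp_all add: finite_below)

lemma pfv_PPi: "pfv (PPi x T t) = pfv T \<union> (pfv t - {x})"
  and pfv_PLam: "pfv (PLam x T t) = pfv T \<union> (pfv t - {x})"
  by (auto simp: pfv_pren below_bind)

lemma ex_notin_finite: "finite X \<Longrightarrow> \<exists>x::nat. x \<notin> X"
  by (simp add: ex_new_if_finite infinite_UNIV_nat)

text \<open>Bridge from nameless to named binders: the condition on \<open>x'\<close> excludes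
  capture, and on terms avoiding \<open>x'\<close> the renaming \<open>bind x'\<close> is just the
  shift.\<close>

lemma psub_pup_bind:
  assumes "\<And>n. n \<in> pfv t - {x} \<Longrightarrow> x' \<notin> pfv (\<sigma> n)"
  shows "psub (pup \<sigma>) (pren (bind x) t) = pren (bind x') (psub (\<sigma>(x := PVar x')) t)"
  unfolding psub_pren pren_psub
proof (rule psub_cong)
  fix n assume n: "n \<in> pfv t"
  show "pup \<sigma> (bind x n) = pren (bind x') ((\<sigma>(x := PVar x')) n)"
  proof (cases "n = x")
    case False
    then have "x' \<notin> pfv (\<sigma> n)" using assms n by blast
    then have "pren Suc (\<sigma> n) = pren (bind x') (\<sigma> n)"
      unfolding pren_eq_psub by (intro psub_cong) (auto simp: bind_def)
    with False show ?thesis by simp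
  qed simp
qed

text \<open>Every nameless body arises from a named one: the witness calls index 0 by the name
  \<open>x\<close> and lowers the other indices. Freshness of \<open>x\<close> keeps the two apart,
  so \<open>bind x\<close> undoes it.\<close>

lemma pbind_exhaust:
  assumes "x \<notin> below (pfv t)"
  obtains t' where "t = pren (bind x) t'"
proof
  have "t = psub (\<lambda>n. PVar (bind x (case_nat x (\<lambda>n. n) n))) t"
    using assms by (intro psub_ident[symmetric]) (auto simp: bind_def split: nat.splits)
  then show "t = pren (bind x) (pren (case_nat x (\<lambda>n. n)) t)"
    by (simp add: pren_pren pren_eq_psub[symmetric])
qed

lemma psub_PPi:
  assumes "\<And>n. n \<in> pfv t - {x} \<Longrightarrow> x' \<notin> pfv (\<sigma> n)"
  shows "psub \<sigma> (PPi x U t) = PPi x' (psub \<sigma> U) (psub (\<sigma>(x := PVar x')) t)"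
    and "psub \<sigma> (PLam x U t) = PLam x' (psub \<sigma> U) (psub (\<sigma>(x := PVar x')) t)"
  using psub_pup_bind[OF assms] by simp_all

lemma psub_upd_notin: "x \<notin> pfv A \<Longrightarrow> psub (\<sigma>(x := u)) A = psub \<sigma> A"
  by (rule psub_cong) auto


section \<open>Beta conversion\<close>

text \<open>Reduction on the nameless representation; unlike for \<open>bred\<close>, closure under substitution
  needs no renaming of binders.\<close>

inductive nbred :: "'s pterm \<Rightarrow> 's pterm \<Rightarrow> bool" where
  nbeta: "nbred (PApp (DPLam v t) u) (psub (case_nat u PVar) t)"
| n_Pi1: "nbred T T' \<Longrightarrow> nbred (DPPi T t) (DPPi T' t)"
| n_Pi2: "nbred t t' \<Longrightarrow> nbred (DPPi T t) (DPPi T t')"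
| n_Lam1: "nbred T T' \<Longrightarrow> nbred (DPLam T t) (DPLam T' t)"
| n_Lam2: "nbred t t' \<Longrightarrow> nbred (DPLam T t) (DPLam T t')"
| n_App1: "nbred t t' \<Longrightarrow> nbred (PApp t u) (PApp t' u)"
| n_App2: "nbred u u' \<Longrightarrow> nbred (PApp t u) (PApp t u')"

lemma nbred_psub: "nbred t t' \<Longrightarrow> nbred (psub \<sigma> t) (psub \<sigma> t')"
proof (induction arbitrary: \<sigma> rule: nbred.induct)
  case (nbeta v t u)
  show ?case unfolding psub_inst by (simp add: nbred.nbeta)
qed (auto intro: nbred.intros)

lemma nbred_pren: "nbred t t' \<Longrightarrow> nbred (pren f t) (pren f t')"
  unfolding pren_eq_psub by (rule nbred_psub)

lemma bred_imp_nbred: "bred t t' \<Longrightarrow> nbred t t'"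
proof (induction rule: bred.induct)
  case (pbeta x v t u)
  show ?case using nbeta[of v "pren (bind x) t" u] by (simp only: inst_bind)
qed (auto intro: nbred.intros nbred_pren)

text \<open>The renaming strengthens the induction. For a step inside a body, the rules of
  \<open>bred\<close> require a named binder, and the induction hypothesis at
  \<open>case_nat x f\<close> performs that step after index 0 has received the name
  \<open>x\<close>.\<close>

lemma nbred_imp_bred_pren: "nbred t t' \<Longrightarrow> bred (pren f t) (pren f t')"
proof (induction arbitrary: f rule: nbred.induct)
  case (nbeta v t u)
  obtain x where "x \<notin> below (pfv (pren (up f) t))"
    using ex_notin_finite[OF finite_below[OF finite_pfv]] by blast
  then obtain t' where t': "pren (up f) t = pren (bind x) t'" by (rule pbind_exhaust)
  show ?case using pbeta[of "pren f v" x t' "pren f u"]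
    unfolding inst_ren pren.simps t' inst_bind .
next
  case (n_Pi1 T T' t)
  obtain x where "x \<notin> below (pfv (pren (up f) t))"
    using ex_notin_finite[OF finite_below[OF finite_pfv]] by blast
  then obtain t' where t': "pren (up f) t = pren (bind x) t'" by (rule pbind_exhaust)
  show ?case unfolding pren.simps t' by (rule pc_Pi1) (rule n_Pi1.IH)
next
  case (n_Lam1 T T' t)
  obtain x where "x \<notin> below (pfv (pren (up f) t))"
    using ex_notin_finite[OF finite_below[OF finite_pfv]] by blast
  then obtain t' where t': "pren (up f) t = pren (bind x) t'" by (rule pbind_exhaust)
  show ?case unfolding pren.simps t' by (rule pc_Lam1) (rule n_Lam1.IH)
next
  case (n_Pi2 t t' T)
  obtain x where x: "x \<notin> f ` (below (pfv t \<union> pfv t'))"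
    using ex_notin_finite[OF finite_imageI[OF finite_below]] finite_pfv by (metis finite_UnI)
  \<comment> \<open>Index 0 goes to \<open>x\<close> and back to 0; an index \<open>Suc n\<close>
    goes to \<open>f n\<close> and then to \<open>Suc (f n)\<close>, since \<open>x\<close> differs
    from \<open>f n\<close>. One name must serve both sides of the step, hence the union in the
    choice of \<open>x\<close>.\<close>
  have "pren (up f) s = pren (bind x) (pren (case_nat x f) s)" if "s = t \<or> s = t'" for s
    unfolding pren_pren unfolding pren_eq_psub
    using that x by (intro psub_cong) (auto simp: bind_def up_def split: nat.splits)
  then show ?case using pc_Pi2[OF n_Pi2.IH[of "case_nat x f"], where x = x and T = "pren f T"] by simp
next
  case (n_Lam2 t t' T)
  obtain x where x: "x \<notin> f ` (below (pfv t \<union> pfv t'))"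
    using ex_notin_finite[OF finite_imageI[OF finite_below]] finite_pfv by (metis finite_UnI)
  have "pren (up f) s = pren (bind x) (pren (case_nat x f) s)" if "s = t \<or> s = t'" for s
    unfolding pren_pren unfolding pren_eq_psub
    using that x by (intro psub_cong) (auto simp: bind_def up_def split: nat.splits)
  then show ?case using pc_Lam2[OF n_Lam2.IH[of "case_nat x f"], where x = x and T = "pren f T"] by simp
qed (auto intro: bred.intros)

lemma bred_eq_nbred: "bred = nbred"
proof (intro ext iffI)
  show "nbred t t' \<Longrightarrow> bred t t'" for t t' :: "'a pterm"
    using nbred_imp_bred_pren[of t t' "\<lambda>n. n"] by (simp add: pren_eq_psub)
qed (rule bred_imp_nbred)

text \<open>Reduces every congruence property of conversion to single steps; the image of a step may
  itself be a conversion, as happens for the translation.\<close>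

lemma equivclp_mono_map:
  assumes "\<And>a b. r a b \<Longrightarrow> equivclp q (f a) (f b)" and "equivclp r a b"
  shows "equivclp q (f a) (f b)"
  using assms(2)
proof (induction rule: equivclp_induct)
  case (step y z)
  then show ?case using assms(1) by (meson equivclp_sym equivclp_trans)
qed simp

lemma pconv_psub: "t \<leftrightarrow>\<^sub>\<beta>\<^sup>* t' \<Longrightarrow> psub \<sigma> t \<leftrightarrow>\<^sub>\<beta>\<^sup>* psub \<sigma> t'"
  unfolding bred_eq_nbred
  by (erule equivclp_mono_map[rotated]) (blast intro: nbred_psub)

lemma equivclp_cong2:
  assumes "\<And>a a' b. r a a' \<Longrightarrow> r (f a b) (f a' b)" and "\<And>a b b'. r b b' \<Longrightarrow> r (f a b) (f a b')"
    and "equivclp r a a'" and "equivclp r b b'"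
  shows "equivclp r (f a b) (f a' b')"
proof (rule equivclp_trans)
  show "equivclp r (f a b) (f a' b)"
    using assms(3) by (rule equivclp_mono_map[rotated]) (blast intro: assms(1))
  show "equivclp r (f a' b) (f a' b')"
    using assms(4) by (rule equivclp_mono_map[rotated]) (blast intro: assms(2))
qed

lemma
  assumes "t \<leftrightarrow>\<^sub>\<beta>\<^sup>* t'" and "u \<leftrightarrow>\<^sub>\<beta>\<^sup>* u'"
  shows pconv_DPPi: "DPPi t u \<leftrightarrow>\<^sub>\<beta>\<^sup>* DPPi t' u'"
    and pconv_DPLam: "DPLam t u \<leftrightarrow>\<^sub>\<beta>\<^sup>* DPLam t' u'"
    and pconv_PApp: "PApp t u \<leftrightarrow>\<^sub>\<beta>\<^sup>* PApp t' u'"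
  using assms unfolding bred_eq_nbred
  by - (rule equivclp_cong2[of nbred]; (assumption | erule n_Pi1 n_Pi2 n_Lam1 n_Lam2 n_App1 n_App2))+

lemma pconv_pren: "t \<leftrightarrow>\<^sub>\<beta>\<^sup>* t' \<Longrightarrow> pren f t \<leftrightarrow>\<^sub>\<beta>\<^sup>* pren f t'"
  unfolding pren_eq_psub by (rule pconv_psub)

lemma psub_pconv: "(\<And>n. \<sigma> n \<leftrightarrow>\<^sub>\<beta>\<^sup>* \<tau> n) \<Longrightarrow> psub \<sigma> t \<leftrightarrow>\<^sub>\<beta>\<^sup>* psub \<tau> t"
proof (induction t arbitrary: \<sigma> \<tau>)
  case (DPPi T t)
  have "pup \<sigma> n \<leftrightarrow>\<^sub>\<beta>\<^sup>* pup \<tau> n" for n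
    by (cases n) (simp_all add: DPPi.prems pconv_pren)
  then show ?case using DPPi by (simp add: pconv_DPPi)
next
  case (DPLam T t)
  have "pup \<sigma> n \<leftrightarrow>\<^sub>\<beta>\<^sup>* pup \<tau> n" for n
    by (cases n) (simp_all add: DPLam.prems pconv_pren)
  then show ?case using DPLam by (simp add: pconv_DPLam)
qed (simp_all add: pconv_PApp)


section \<open>Applying a term to a list\<close>

text \<open>This is the translation of a list with the term \<open>u\<close> already placed in the
  hole, computed without fresh names. In the last clause \<open>u\<close> is shifted because it
  lives outside the binder and must escape the instantiation.\<close>

primrec appl :: "'s pterm \<Rightarrow> 's lst \<Rightarrow> 's pterm" where
  "appl u LNil = u"
| "appl u (LCons M l) = appl (PApp u (\<B> M)) l"
| "appl u (LApp l l') = appl (appl u l) l'"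
| "appl u (DLSub P A l) = psub (case_nat (\<B> P) PVar) (appl (pren Suc u) l)"

text \<open>Mutual induction with the trivial predicate on terms: \<open>appl\<close> treats the
  terms inside a list only through \<open>\<B>\<close>.\<close>

lemma lst_induct [case_names LNil LCons LApp DLSub]:
  assumes "P LNil" and "\<And>M l. P l \<Longrightarrow> P (LCons M l)" and "\<And>l l'. P l \<Longrightarrow> P l' \<Longrightarrow> P (LApp l l')"
    and "\<And>Q A l. P l \<Longrightarrow> P (DLSub Q A l)"
  shows "P l"
  using assms by (rule lst.induct[of "\<lambda>_. True", rotated 6]) simp_all

lemma psub_\<B>_ident: "(\<And>n. n \<in> fv M \<Longrightarrow> \<sigma> n = PVar n) \<Longrightarrow> psub \<sigma> (\<B> M) = \<B> M"
  using pfv_\<B>[of M] by (blast intro: psub_ident)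

text \<open>Lifting preserves being the identity on the free variables, so the induction passes the
  binder of \<open>DLSub\<close>. With a fresh hole this lets the head be substituted
  afterwards.\<close>

lemma psub_appl_ident:
  "(\<And>n. n \<in> lfv l \<Longrightarrow> \<sigma> n = PVar n) \<Longrightarrow> psub \<sigma> (appl u l) = appl (psub \<sigma> u) l"
proof (induction l arbitrary: \<sigma> u rule: lst_induct)
  case (LCons M l)
  then show ?case by (simp add: psub_\<B>_ident)
next
  case (DLSub P A l)
  have "pup \<sigma> n = PVar n" if "n \<in> lfv l" for n
    using that DLSub.prems by (cases n) auto
  from DLSub.IH[OF this]
  have "psub (pup \<sigma>) (appl (pren Suc u) l) = appl (pren Suc (psub \<sigma> u)) l"
    by (simp add: psub_pren pren_psub)
  moreover have "psub \<sigma> (\<B> P) = \<B> P"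
    using DLSub.prems by (simp add: psub_\<B>_ident)
  ultimately show ?case by (simp add: psub_inst)
qed simp_all

lemma appl_subst: "z \<notin> lfv l \<Longrightarrow> appl u l = (appl (PVar z) l){z:=u}"
  by (subst psub_appl_ident) auto

text \<open>The substitution for the fresh variable in each clause is exactly
  \<open>appl_subst\<close> read backwards, so the fresh choices disappear from the rest of the
  proof.\<close>

lemma \<B>\<^sub>l_eq_appl: "\<B>\<^sub>l y l = appl (PVar y) l"
proof (induction l arbitrary: y rule: lst_induct)
  case (LCons M l)
  let ?z = "fresh (insert y (fv M \<union> lfv l))"
  have "?z \<notin> lfv l" by (rule fresh_lren) (auto simp: finite_fv finite_lfv)
  then show ?case using LCons by (simp add: Let_def appl_subst[symmetric])
next
  case (LApp l l')
  let ?z = "fresh (insert y (lfv l \<union> lfv l'))"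
  have "?z \<notin> lfv l'" by (rule fresh_lren) (auto simp: finite_lfv)
  then show ?case using LApp by (simp add: Let_def appl_subst[symmetric])
qed simp_all

lemma \<B>_appl: "\<B> (VApp x l) = appl (PVar x) l" "\<B> (TApp M l) = appl (\<B> M) l"
proof -
  obtain z where z: "z \<notin> lfv l" using ex_notin_finite[OF finite_lfv] by blast
  show "\<B> (VApp x l) = appl (PVar x) l" "\<B> (TApp M l) = appl (\<B> M) l"
    unfolding \<B>_named(3)[OF z] \<B>_named(4)[OF z] \<B>\<^sub>l_eq_appl appl_subst[OF z, symmetric] by simp_all
qed

text \<open>With a hole outside the list, the effects on head and list merge into one simultaneous
  substitution on a fixed term.\<close>

lemma psub_appl:
  assumes "z \<notin> lfv l"
  shows "psub \<sigma> (appl u l) = psub (\<sigma>(z := psub \<sigma> u)) (appl (PVar z) l)"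
  unfolding appl_subst[OF assms, of u] psub_psub by (rule psub_cong) auto

lemma psub_appl_cong: "psub \<sigma> u = psub \<sigma> v \<Longrightarrow> psub \<sigma> (appl u l) = psub \<sigma> (appl v l)"
  using ex_notin_finite[OF finite_lfv, of l] psub_appl[of _ l \<sigma> u] psub_appl[of _ l \<sigma> v] by auto

lemma appl_PVar_lren: "appl (PVar (f z)) (lren f l) = pren f (appl (PVar z) l)"
  using \<B>\<^sub>l_ren unfolding \<B>\<^sub>l_eq_appl .

text \<open>Named form of the \<open>DLSub\<close> clause. The substitution is simultaneous because
  \<open>u\<close> may contain \<open>x\<close>, and those occurrences must stay.\<close>

lemma appl_LSub:
  assumes "z \<notin> lfv l" and "z \<noteq> x"
  shows "appl u (LSub P x A l) = psub (PVar(x := \<B> P, z := u)) (appl (PVar z) l)"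
proof -
  have z: "bind x z \<notin> lfv (lren (bind x) l)"
    using assms unfolding lfv_lren by (auto simp: bind_def split: if_splits)
  show ?thesis
    unfolding appl.simps psub_appl[OF z, of _ "pren Suc u"] appl_PVar_lren psub_pren
    using assms by (intro psub_cong) (auto simp: bind_def)
qed

text \<open>Justifies the rules moving an explicit substitution into an application: the meta-level
  substitution on the list is precisely what \<open>LSub\<close> denotes.\<close>

lemma subst_appl: "(appl u l){x:=\<B> P} = appl (u{x:=\<B> P}) (LSub P x A l)"
proof -
  obtain z where z: "z \<notin> insert x (lfv l)"
    using ex_notin_finite finite_lfv finite.insertI by metis
  then show ?thesis using appl_LSub[of z l x "u{x:=\<B> P}" P A] psub_appl[of z l _ u] by simp
qed

lemma pconv_appl:
  assumes "u \<leftrightarrow>\<^sub>\<beta>\<^sup>* v"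
  shows "appl u l \<leftrightarrow>\<^sub>\<beta>\<^sup>* appl v l"
proof -
  obtain z where z: "z \<notin> lfv l" using ex_notin_finite[OF finite_lfv] by blast
  show ?thesis
    unfolding appl_subst[OF z, of u] appl_subst[OF z, of v] by (rule psub_pconv) (simp add: assms)
qed


section \<open>Simulation of reduction\<close>

text \<open>The head \<open>u\<close> is arbitrary because steps inside a list are seen with
  different heads: a step behind \<open>LCons M\<close> has the head \<open>PApp u (\<B> M)\<close>.
  Apart from \<open>beta\<close>, the root rules become equalities, and the remaining rules are
  congruences.\<close>

lemma red_pconv:
  fixes M N :: "'s trm" and l l' :: "'s lst"
  shows "red M N \<Longrightarrow> \<B> M \<leftrightarrow>\<^sub>\<beta>\<^sup>* \<B> N" and "lred l l' \<Longrightarrow> appl u l \<leftrightarrow>\<^sub>\<beta>\<^sup>* appl u l'"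
proof (induction M N and l l' arbitrary: and u rule: red_lred.inducts)
  case (beta x A M N l)
  have "PApp (PLam x (\<B> A) (\<B> M)) (\<B> N) \<leftrightarrow>\<^sub>\<beta>\<^sup>* (\<B> M){x:=\<B> N}"
    using pbeta by blast
  then show ?case unfolding \<B>_appl appl.simps \<B>_named by (rule pconv_appl)
next
  case (sub_Lam x y P G A M)
  then have "x \<notin> pfv (\<B> P)" using pfv_\<B> by blast
  then show ?case unfolding \<B>_named subst_named(6)[OF \<open>x \<noteq> y\<close> \<open>x \<notin> pfv (\<B> P)\<close>]
    by simp
next
  case (sub_Pi x y P G A M)
  then have "x \<notin> pfv (\<B> P)" using pfv_\<B> by blast
  then show ?case unfolding \<B>_named subst_named(5)[OF \<open>x \<noteq> y\<close> \<open>x \<notin> pfv (\<B> P)\<close>]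
    by simp
next
  case (sub_var_eq P y G l)
  show ?case unfolding \<B>_named \<B>_appl subst_appl[where A = G] by simp
next
  case (sub_var_neq x y P G l)
  then show ?case unfolding \<B>_named \<B>_appl subst_appl[where A = G] by simp
next
  case (sub_app P y G M l)
  show ?case unfolding \<B>_named \<B>_appl subst_appl[where A = G] by simp
next
  case (sub_cons P y G M l)
  have "appl u (LSub P y G (LCons M l)) = appl u (LCons (Sub P y G M) (LSub P y G l))"
    \<comment> \<open>The two heads differ only before the instantiation of index 0, which turns
      both into the same application.\<close>
    by (simp, rule psub_appl_cong) (simp add: \<B>_ren)
  then show ?case by simp
next
  case (sub_append P y G l l')
  have "appl u (LSub P y G (LApp l l')) = appl u (LApp (LSub P y G l) (LSub P y G l'))"
    by (simp, rule psub_appl_cong) simp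
  then show ?case by simp
next
  case (c_LSub3 l l' P x A)
  \<comment> \<open>A common hole for both lists lets one substitution be applied to the induction
    hypothesis at head \<open>PVar z\<close>.\<close>
  obtain z where z: "z \<notin> insert x (lfv l \<union> lfv l')"
    using ex_notin_finite finite_lfv finite.insertI finite_UnI by metis
  then have "z \<notin> lfv l" "z \<notin> lfv l'" "z \<noteq> x" by auto
  then show ?case
    unfolding appl_LSub[OF \<open>z \<notin> lfv l\<close> \<open>z \<noteq> x\<close>] appl_LSub[OF \<open>z \<notin> lfv l'\<close> \<open>z \<noteq> x\<close>]
    by (intro pconv_psub c_LSub3.IH)
next
  case (c_Sub1 P P' x A M)
  then show ?case unfolding \<B>_named by (intro psub_pconv) simp
next
  case (c_Sub3 M M' P x A)
  then show ?case unfolding \<B>_named by (intro pconv_psub)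
next
  case (c_LSub1 P P' x A l)
  have "case_nat (\<B> P) PVar n \<leftrightarrow>\<^sub>\<beta>\<^sup>* case_nat (\<B> P') PVar n" for n
    using c_LSub1.IH by (cases n) simp_all
  then show ?case unfolding appl.simps by (rule psub_pconv)
next
  case (c_LApp2 l2 l2' l1)
  then show ?case by simp
qed (simp_all only: \<B>_appl appl.simps \<B>.simps \<B>_ren ren.simps lren.simps psub.simps inst_shift
      equivclp_refl pconv_appl pconv_DPPi pconv_DPLam pconv_PApp pconv_pren)

lemma conv_imp_pconv: "M \<leftrightarrow>\<^sup>* N \<Longrightarrow> \<B> M \<leftrightarrow>\<^sub>\<beta>\<^sup>* \<B> N"
  by (erule equivclp_mono_map[rotated]) (rule red_pconv)

section \<open>Translated environments\<close>

lemma \<B>\<^sub>e_simps [simp]: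
  "\<B>\<^sub>e [] = []" "\<B>\<^sub>e (\<Gamma> @ \<Delta>) = \<B>\<^sub>e \<Gamma> @ \<B>\<^sub>e \<Delta>" "\<B>\<^sub>e ((x, A) # \<Gamma>) = (x, \<B> A) # \<B>\<^sub>e \<Gamma>"
  "edom (\<B>\<^sub>e \<Gamma>) = edom \<Gamma>"
  by (auto simp: \<B>\<^sub>e_def image_image case_prod_beta)

lemma set_\<B>\<^sub>e: "(x, T) \<in> set (\<B>\<^sub>e \<Gamma>) \<longleftrightarrow> (\<exists>A. (x, A) \<in> set \<Gamma> \<and> T = \<B> A)"
  by (auto simp: \<B>\<^sub>e_def)


section \<open>Weakening and substitution in PTS\<close>

context pts_spec
begin

lemma pts_wf_snoc:
  assumes "(\<Gamma> @ [(x, A)]) wf\<^sub>P\<^sub>T\<^sub>S"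
  shows "x \<notin> edom \<Gamma>" and "\<exists>s. \<Gamma> \<turnstile>\<^sub>P\<^sub>T\<^sub>S A \<^bold>: PSort s"
  using assms by (auto elim: pts_wf.cases)

lemma pts_typ_wf: "\<Gamma> \<turnstile>\<^sub>P\<^sub>T\<^sub>S t \<^bold>: T \<Longrightarrow> \<Gamma> wf\<^sub>P\<^sub>T\<^sub>S"
  by (induction rule: pts_wf_pts_typ.inducts(2)[where ?P1.0 = "\<lambda>_. True"]) auto

lemma pts_wf_prefix: "(\<Gamma> @ \<Delta>) wf\<^sub>P\<^sub>T\<^sub>S \<Longrightarrow> \<Gamma> wf\<^sub>P\<^sub>T\<^sub>S"
proof (induction \<Delta> rule: rev_induct)
  case (snoc a \<Delta>)
  then show ?case using pts_wf_snoc(2)[of "\<Gamma> @ \<Delta>" "fst a" "snd a"] pts_typ_wf by fastforce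
qed simp

lemma pts_wf_distinct: "\<Gamma> wf\<^sub>P\<^sub>T\<^sub>S \<Longrightarrow> distinct (map fst \<Gamma>)"
proof (induction \<Gamma> rule: rev_induct)
  case (snoc a \<Gamma>)
  then show ?case
    using pts_wf_snoc(1)[of \<Gamma> "fst a" "snd a"] pts_wf_prefix by fastforce
qed simp

lemma pts_typ_pfv: "\<Gamma> \<turnstile>\<^sub>P\<^sub>T\<^sub>S t \<^bold>: T \<Longrightarrow> pfv t \<subseteq> edom \<Gamma>"
proof (induction rule: pts_wf_pts_typ.inducts(2)[where ?P1.0 = "\<lambda>_. True"])
  case (p_var \<Gamma> x T)
  then show ?case by force
next
  case (p_Pi \<Gamma> U s1 x T s2 s3)
  then show ?case unfolding pfv_PPi by auto
next
  case (p_Lam \<Gamma> x U T s t)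
  then show ?case unfolding pfv_PPi pfv_PLam by auto
qed auto

lemma pts_wf_pfv: "\<Gamma> wf\<^sub>P\<^sub>T\<^sub>S \<Longrightarrow> (x, A) \<in> set \<Gamma> \<Longrightarrow> pfv A \<subseteq> edom \<Gamma>"
proof (induction \<Gamma> rule: rev_induct)
  case (snoc a \<Gamma>)
  obtain y B where a: "a = (y, B)" by force
  with snoc.prems(1) have "pfv B \<subseteq> edom \<Gamma>"
    using pts_wf_snoc(2) pts_typ_pfv by blast
  then show ?case
    using snoc a pts_wf_prefix[of \<Gamma> "[a]"] by auto
qed simp

text \<open>Induction skips the conversion steps, and the formation rule then supplies the sort. It
  is needed to extend an environment under a lambda, whose rule only provides typability of the
  product.\<close>

lemma pts_Pi_dom: "\<Gamma> \<turnstile>\<^sub>P\<^sub>T\<^sub>S DPPi U T \<^bold>: V \<Longrightarrow> \<exists>s. \<Gamma> \<turnstile>\<^sub>P\<^sub>T\<^sub>S U \<^bold>: PSort s"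
  by (induction \<Gamma> "DPPi U T" V rule: pts_wf_pts_typ.inducts(2)[where ?P1.0 = "\<lambda>_. True"]) auto

text \<open>After a substitution the body of a product type is only known namelessly; any fresh name
  turns it back into the form required by \<open>p_app\<close>.\<close>

lemma p_app_inst:
  assumes "\<Gamma> \<turnstile>\<^sub>P\<^sub>T\<^sub>S t \<^bold>: DPPi U T" and "\<Gamma> \<turnstile>\<^sub>P\<^sub>T\<^sub>S u \<^bold>: U"
  shows "\<Gamma> \<turnstile>\<^sub>P\<^sub>T\<^sub>S PApp t u \<^bold>: psub (case_nat u PVar) T"
proof -
  obtain x where "x \<notin> below (pfv T)"
    using ex_notin_finite[OF finite_below[OF finite_pfv]] by blast
  then obtain T' where T': "T = pren (bind x) T'" by (rule pbind_exhaust)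
  show ?thesis using p_app[OF assms[unfolded T']] unfolding T' inst_bind .
qed

text \<open>The relation \<open>K\<close> is instantiated first with renamings, which yields weakening, and then with
  all well-typed substitutions, whose closure under extension needs weakening.\<close>

lemma pts_psub_closed:
  assumes wf: "\<And>\<sigma> \<Gamma> \<Delta>. K \<sigma> \<Gamma> \<Delta> \<Longrightarrow> \<Delta> wf\<^sub>P\<^sub>T\<^sub>S"
    and var: "\<And>\<sigma> \<Gamma> \<Delta> x A. K \<sigma> \<Gamma> \<Delta> \<Longrightarrow> (x, A) \<in> set \<Gamma> \<Longrightarrow> \<Delta> \<turnstile>\<^sub>P\<^sub>T\<^sub>S \<sigma> x \<^bold>: psub \<sigma> A"
    and ext: "\<And>\<sigma> \<Gamma> \<Delta> x x' U. K \<sigma> \<Gamma> \<Delta> \<Longrightarrow> (\<Gamma> @ [(x, U)]) wf\<^sub>P\<^sub>T\<^sub>S \<Longrightarrow>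
      (\<Delta> @ [(x', psub \<sigma> U)]) wf\<^sub>P\<^sub>T\<^sub>S \<Longrightarrow>
      K (\<sigma>(x := PVar x')) (\<Gamma> @ [(x, U)]) (\<Delta> @ [(x', psub \<sigma> U)])"
    and "\<Gamma> \<turnstile>\<^sub>P\<^sub>T\<^sub>S t \<^bold>: T" and "K \<sigma> \<Gamma> \<Delta>"
  shows "\<Delta> \<turnstile>\<^sub>P\<^sub>T\<^sub>S psub \<sigma> t \<^bold>: psub \<sigma> T"
  using assms(4,5)
proof (induction arbitrary: \<sigma> \<Delta> rule: pts_wf_pts_typ.inducts(2)[where ?P1.0 = "\<lambda>_. True"])
  case (p_var \<Gamma> x T)
  then show ?case by (simp add: var)
next
  case (p_sort \<Gamma> s s')
  then show ?case using pts_wf_pts_typ.p_sort wf by simp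
next
  case (p_Pi \<Gamma> U s1 x T s2 s3)
  obtain x' where x': "x' \<notin> edom \<Delta>" using ex_notin_finite[of "edom \<Delta>"] by auto
  \<comment> \<open>The terms put in for variables of \<open>\<Gamma>\<close> are typed in
    \<open>\<Delta>\<close>, so their free variables lie in its domain and \<open>x'\<close> cannot
    be captured.\<close>
  have fr: "x' \<notin> pfv (\<sigma> n)" if "n \<in> pfv T - {x}" for n
  proof -
    have "n \<in> edom \<Gamma>" using pts_typ_pfv[OF p_Pi.hyps(2)] that by auto
    then show ?thesis using var[OF p_Pi.prems] pts_typ_pfv x' by fastforce
  qed
  have U: "\<Delta> \<turnstile>\<^sub>P\<^sub>T\<^sub>S psub \<sigma> U \<^bold>: PSort s1" using p_Pi.IH(1)[OF p_Pi.prems] by simp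
  have "K (\<sigma>(x := PVar x')) (\<Gamma> @ [(x, U)]) (\<Delta> @ [(x', psub \<sigma> U)])"
    using ext[OF p_Pi.prems pts_typ_wf[OF p_Pi.hyps(2)] pwf_extend[OF U x']] .
  from p_Pi.IH(2)[OF this]
  have "\<Delta> @ [(x', psub \<sigma> U)] \<turnstile>\<^sub>P\<^sub>T\<^sub>S psub (\<sigma>(x := PVar x')) T \<^bold>: PSort s2"
    by (simp only: psub.simps)
  from pts_wf_pts_typ.p_Pi[OF U this p_Pi.hyps(3)] show ?case
    using psub_PPi(1)[of T x x' \<sigma> U] fr by simp
next
  case (p_Lam \<Gamma> x U T s t)
  obtain x' where x': "x' \<notin> edom \<Delta>" using ex_notin_finite[of "edom \<Delta>"] by auto
  have fr: "x' \<notin> pfv (\<sigma> n)" if "n \<in> pfv t - {x} \<or> n \<in> pfv T - {x}" for n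
  proof -
    have "n \<in> edom \<Gamma>"
      using pts_typ_pfv[OF p_Lam.hyps(2)] pts_typ_pfv[OF p_Lam.hyps(1), unfolded pfv_PPi] that by auto
    then show ?thesis using var[OF p_Lam.prems] pts_typ_pfv x' by fastforce
  qed
  have Pi: "\<Delta> \<turnstile>\<^sub>P\<^sub>T\<^sub>S PPi x' (psub \<sigma> U) (psub (\<sigma>(x := PVar x')) T) \<^bold>: PSort s"
    using p_Lam.IH(1)[OF p_Lam.prems] psub_PPi(1)[of T x x' \<sigma> U] fr by simp
  then obtain s1 where U: "\<Delta> \<turnstile>\<^sub>P\<^sub>T\<^sub>S psub \<sigma> U \<^bold>: PSort s1" using pts_Pi_dom by blast
  have "K (\<sigma>(x := PVar x')) (\<Gamma> @ [(x, U)]) (\<Delta> @ [(x', psub \<sigma> U)])"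
    using ext[OF p_Lam.prems pts_typ_wf[OF p_Lam.hyps(2)] pwf_extend[OF U x']] .
  from pts_wf_pts_typ.p_Lam[OF Pi p_Lam.IH(2)[OF this]] show ?case
    using psub_PPi(1)[of T x x' \<sigma> U] psub_PPi(2)[of t x x' \<sigma> U] fr by (simp add: fun_upd_def)
next
  case (p_app \<Gamma> t x U T u)
  have "\<Delta> \<turnstile>\<^sub>P\<^sub>T\<^sub>S PApp (psub \<sigma> t) (psub \<sigma> u) \<^bold>:
      psub (case_nat (psub \<sigma> u) PVar) (psub (pup \<sigma>) (pren (bind x) T))"
    using p_app.IH(1)[OF p_app.prems] p_app.IH(2)[OF p_app.prems] by (intro p_app_inst) simp_all
  then show ?case unfolding psub_inst[symmetric] inst_bind by simp
next
  case (p_conv \<Gamma> t U V s)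
  have "\<Delta> \<turnstile>\<^sub>P\<^sub>T\<^sub>S psub \<sigma> V \<^bold>: PSort s" using p_conv.IH(2)[OF p_conv.prems] by simp
  then show ?case
    using pts_wf_pts_typ.p_conv[OF p_conv.IH(1)[OF p_conv.prems] _ pconv_psub] p_conv.hyps by blast
qed auto

text \<open>The instance of the closure principle for variable-to-variable maps, taken at the
  identity. Its relation is stable under longer targets because it asks only for membership of a
  declaration, not for a derivation.\<close>

lemma pts_weaken:
  assumes "\<Gamma> \<turnstile>\<^sub>P\<^sub>T\<^sub>S t \<^bold>: T" and "set \<Gamma> \<subseteq> set \<Delta>" and "\<Delta> wf\<^sub>P\<^sub>T\<^sub>S"
  shows "\<Delta> \<turnstile>\<^sub>P\<^sub>T\<^sub>S t \<^bold>: T"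
proof -
  let ?K = "\<lambda>\<sigma> \<Gamma> \<Delta>. \<Delta> wf\<^sub>P\<^sub>T\<^sub>S \<and> (\<forall>(x, A) \<in> set \<Gamma>. \<exists>y. \<sigma> x = PVar y \<and> (y, psub \<sigma> A) \<in> set \<Delta>)"
  have "\<Delta> \<turnstile>\<^sub>P\<^sub>T\<^sub>S psub PVar t \<^bold>: psub PVar T"
  proof (rule pts_psub_closed[of ?K])
    fix \<sigma> :: "nat \<Rightarrow> 's pterm" and \<Gamma> \<Delta> x x' U
    assume K: "?K \<sigma> \<Gamma> \<Delta>" and wf: "(\<Gamma> @ [(x, U)]) wf\<^sub>P\<^sub>T\<^sub>S" "(\<Delta> @ [(x', psub \<sigma> U)]) wf\<^sub>P\<^sub>T\<^sub>S"
    have x: "x \<notin> edom \<Gamma>" using pts_wf_snoc(1)[OF wf(1)] .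
    then have "x \<notin> pfv A" "y \<noteq> x" if "(y, A) \<in> set \<Gamma>" for y A
      using pts_wf_pfv[OF pts_wf_prefix[OF wf(1)] that] that by force+
    moreover have "x \<notin> pfv U"
      using pts_wf_snoc(2)[OF wf(1)] pts_typ_pfv x by blast
    moreover have "\<exists>z. \<sigma> y = PVar z \<and> (z, psub \<sigma> A) \<in> set \<Delta>" if "(y, A) \<in> set \<Gamma>" for y A
      using K that by blast
    ultimately show "?K (\<sigma>(x := PVar x')) (\<Gamma> @ [(x, U)]) (\<Delta> @ [(x', psub \<sigma> U)])"
      using wf(2) by (auto simp: psub_upd_notin) blast
  next
    fix \<sigma> :: "nat \<Rightarrow> 's pterm" and \<Gamma> \<Delta> x A
    assume K: "?K \<sigma> \<Gamma> \<Delta>" and "(x, A) \<in> set \<Gamma>"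
    then obtain y where "\<sigma> x = PVar y" "(y, psub \<sigma> A) \<in> set \<Delta>" by blast
    with K show "\<Delta> \<turnstile>\<^sub>P\<^sub>T\<^sub>S \<sigma> x \<^bold>: psub \<sigma> A" by (simp add: p_var)
  qed (use assms in auto)
  then show ?thesis by simp
qed

text \<open>The relation now demands derivations for all declared variables; when a binder extends
  the target, \<open>pts_weaken\<close> carries them along.\<close>

lemma pts_psub:
  assumes "\<Gamma> \<turnstile>\<^sub>P\<^sub>T\<^sub>S t \<^bold>: T" and "\<Delta> wf\<^sub>P\<^sub>T\<^sub>S"
    and "\<And>x A. (x, A) \<in> set \<Gamma> \<Longrightarrow> \<Delta> \<turnstile>\<^sub>P\<^sub>T\<^sub>S \<sigma> x \<^bold>: psub \<sigma> A"
  shows "\<Delta> \<turnstile>\<^sub>P\<^sub>T\<^sub>S psub \<sigma> t \<^bold>: psub \<sigma> T"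
proof -
  let ?K = "\<lambda>\<sigma> \<Gamma> \<Delta>. \<Delta> wf\<^sub>P\<^sub>T\<^sub>S \<and> (\<forall>(x, A) \<in> set \<Gamma>. \<Delta> \<turnstile>\<^sub>P\<^sub>T\<^sub>S \<sigma> x \<^bold>: psub \<sigma> A)"
  show ?thesis
  proof (rule pts_psub_closed[of ?K])
    fix \<sigma> :: "nat \<Rightarrow> 's pterm" and \<Gamma> \<Delta> x x' U
    assume K: "?K \<sigma> \<Gamma> \<Delta>" and wf: "(\<Gamma> @ [(x, U)]) wf\<^sub>P\<^sub>T\<^sub>S" "(\<Delta> @ [(x', psub \<sigma> U)]) wf\<^sub>P\<^sub>T\<^sub>S"
    have x: "x \<notin> edom \<Gamma>" using pts_wf_snoc(1)[OF wf(1)] .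
    then have "x \<notin> pfv A" "y \<noteq> x" if "(y, A) \<in> set \<Gamma>" for y A
      using pts_wf_pfv[OF pts_wf_prefix[OF wf(1)] that] that by force+
    moreover have "x \<notin> pfv U"
      using pts_wf_snoc(2)[OF wf(1)] pts_typ_pfv x by blast
    moreover have "\<Delta> @ [(x', psub \<sigma> U)] \<turnstile>\<^sub>P\<^sub>T\<^sub>S \<sigma> y \<^bold>: psub \<sigma> A" if "(y, A) \<in> set \<Gamma>" for y A
      using K that by (intro pts_weaken[OF _ _ wf(2)]) auto
    moreover have "\<Delta> @ [(x', psub \<sigma> U)] \<turnstile>\<^sub>P\<^sub>T\<^sub>S PVar x' \<^bold>: psub \<sigma> U"
      using wf(2) by (intro p_var) simp_all
    ultimately show "?K (\<sigma>(x := PVar x')) (\<Gamma> @ [(x, U)]) (\<Delta> @ [(x', psub \<sigma> U)])"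
      using wf(2) by (auto simp: psub_upd_notin)
  qed (use assms in auto)
qed

text \<open>Exact types are recovered from left to right along \<open>\<Gamma>\<close>: a declared
  type is typed in the preceding part, where exact typing is already known, so its substituted form
  has a sort and the conversion rule applies.\<close>

lemma pts_psub_conv:
  assumes "\<Gamma> \<turnstile>\<^sub>P\<^sub>T\<^sub>S t \<^bold>: T" and "\<Delta> wf\<^sub>P\<^sub>T\<^sub>S"
    and "\<And>x A. (x, A) \<in> set \<Gamma> \<Longrightarrow> \<exists>B. \<Delta> \<turnstile>\<^sub>P\<^sub>T\<^sub>S \<sigma> x \<^bold>: B \<and> B \<leftrightarrow>\<^sub>\<beta>\<^sup>* psub \<sigma> A"
  shows "\<Delta> \<turnstile>\<^sub>P\<^sub>T\<^sub>S psub \<sigma> t \<^bold>: psub \<sigma> T"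
proof (rule pts_psub[OF assms(1,2)])
  have "\<forall>(x, A) \<in> set \<Gamma>. \<Delta> \<turnstile>\<^sub>P\<^sub>T\<^sub>S \<sigma> x \<^bold>: psub \<sigma> A"
    using pts_typ_wf[OF assms(1)] assms(3)
  proof (induction \<Gamma> rule: rev_induct)
    case (snoc a \<Gamma>)
    obtain x A where a: "a = (x, A)" by force
    have IH: "\<forall>(x, A) \<in> set \<Gamma>. \<Delta> \<turnstile>\<^sub>P\<^sub>T\<^sub>S \<sigma> x \<^bold>: psub \<sigma> A"
    proof (rule snoc.IH)
      show "\<Gamma> wf\<^sub>P\<^sub>T\<^sub>S" using snoc.prems(1) by (rule pts_wf_prefix)
    qed (simp add: snoc.prems(2))
    obtain s where "\<Gamma> \<turnstile>\<^sub>P\<^sub>T\<^sub>S A \<^bold>: PSort s" using snoc.prems(1) pts_wf_snoc(2) a by blast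
    then have "\<Delta> \<turnstile>\<^sub>P\<^sub>T\<^sub>S psub \<sigma> A \<^bold>: psub \<sigma> (PSort s)"
      by (rule pts_psub[OF _ assms(2)]) (use IH in blast)
    then have "\<Delta> \<turnstile>\<^sub>P\<^sub>T\<^sub>S psub \<sigma> A \<^bold>: PSort s" by simp
    moreover obtain B where "\<Delta> \<turnstile>\<^sub>P\<^sub>T\<^sub>S \<sigma> x \<^bold>: B" "B \<leftrightarrow>\<^sub>\<beta>\<^sup>* psub \<sigma> A"
      using snoc.prems(2)[of x A] a by auto
    ultimately have "\<Delta> \<turnstile>\<^sub>P\<^sub>T\<^sub>S \<sigma> x \<^bold>: psub \<sigma> A" by (blast intro: p_conv)
    with IH a show ?case by simp
  qed simp
  then show "\<And>x A. (x, A) \<in> set \<Gamma> \<Longrightarrow> \<Delta> \<turnstile>\<^sub>P\<^sub>T\<^sub>S \<sigma> x \<^bold>: psub \<sigma> A" by blast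
qed


section \<open>Preservation of typing\<close>

text \<open>Substitution into the hole. Well-formedness keeps \<open>z\<close> out of
  \<open>B\<close> and of the types in \<open>\<Gamma>\<close>, so only the hole itself
  changes.\<close>

lemma appl_typ:
  assumes "\<Gamma> @ [(z, B)] \<turnstile>\<^sub>P\<^sub>T\<^sub>S appl (PVar z) l \<^bold>: C"
    and "z \<notin> lfv l" and "z \<notin> pfv C"
    and "set \<Gamma> \<subseteq> set \<Delta>" and "\<Delta> \<turnstile>\<^sub>P\<^sub>T\<^sub>S u \<^bold>: B"
  shows "\<Delta> \<turnstile>\<^sub>P\<^sub>T\<^sub>S appl u l \<^bold>: C"
proof -
  have wf: "(\<Gamma> @ [(z, B)]) wf\<^sub>P\<^sub>T\<^sub>S" using assms(1) by (rule pts_typ_wf)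
  have \<Delta>: "\<Delta> wf\<^sub>P\<^sub>T\<^sub>S" using assms(5) by (rule pts_typ_wf)
  have z: "z \<notin> edom \<Gamma>" using pts_wf_snoc(1)[OF wf] .
  have B: "z \<notin> pfv B" using pts_wf_snoc(2)[OF wf] pts_typ_pfv z by blast
  have "\<Delta> \<turnstile>\<^sub>P\<^sub>T\<^sub>S (appl (PVar z) l){z:=u} \<^bold>: C{z:=u}"
  proof (rule pts_psub[OF assms(1) \<Delta>])
    fix x A assume "(x, A) \<in> set (\<Gamma> @ [(z, B)])"
    then consider "(x, A) \<in> set \<Gamma>" | "x = z" "A = B" by auto
    then show "\<Delta> \<turnstile>\<^sub>P\<^sub>T\<^sub>S (PVar(z := u)) x \<^bold>: A{z:=u}"
    proof cases
      case 1
      then have "x \<noteq> z" "z \<notin> pfv A"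
        using z pts_wf_pfv[OF pts_wf_prefix[OF wf] 1] by force+
      then show ?thesis using 1 assms(4) \<Delta> by (auto simp: subst_notin intro: p_var)
    next
      case 2
      then show ?thesis using B assms(5) by (simp add: subst_notin)
    qed
  qed
  then show ?thesis using assms(2,3) by (simp add: appl_subst[symmetric] subst_notin)
qed

text \<open>The induction predicate for list judgments; quantifying over all holes matches the
  freshness in the theorem.\<close>

definition list_typ :: "'s penv \<Rightarrow> 's pterm \<Rightarrow> 's lst \<Rightarrow> 's pterm \<Rightarrow> bool" where
  "list_typ \<Gamma> B l C \<longleftrightarrow> (\<forall>y. y \<notin> edom \<Gamma> \<longrightarrow> \<Gamma> @ [(y, B)] \<turnstile>\<^sub>P\<^sub>T\<^sub>S appl (PVar y) l \<^bold>: C)"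

lemma ex_fresh: "finite X \<Longrightarrow> \<exists>z. z \<notin> edom \<Gamma> \<and> z \<notin> lfv l \<and> z \<notin> pfv C \<and> z \<notin> X"
  using ex_notin_finite[of "edom \<Gamma> \<union> lfv l \<union> pfv C \<union> X"] by (simp add: finite_lfv finite_pfv)

text \<open>A single sufficiently fresh hole suffices, since filling it with \<open>PVar y\<close>
  yields the judgment for any other hole \<open>y\<close>. The finite set \<open>X\<close> collects
  names to be avoided.\<close>

lemma list_typI:
  assumes "finite X" and "\<And>z. z \<notin> edom \<Gamma> \<Longrightarrow> z \<notin> X \<Longrightarrow> \<Gamma> @ [(z, B)] \<turnstile>\<^sub>P\<^sub>T\<^sub>S appl (PVar z) l \<^bold>: C"
  shows "list_typ \<Gamma> B l C"
  unfolding list_typ_def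
proof (intro allI impI)
  fix y assume y: "y \<notin> edom \<Gamma>"
  obtain z where z: "z \<notin> edom \<Gamma>" "z \<notin> lfv l" "z \<notin> pfv C" "z \<notin> X"
    using ex_fresh[OF assms(1)] by blast
  note l = assms(2)[OF z(1,4)]
  obtain s where "\<Gamma> \<turnstile>\<^sub>P\<^sub>T\<^sub>S B \<^bold>: PSort s" using pts_wf_snoc(2)[OF pts_typ_wf[OF l]] by blast
  then have "\<Gamma> @ [(y, B)] \<turnstile>\<^sub>P\<^sub>T\<^sub>S PVar y \<^bold>: B" using y by (intro p_var pwf_extend) simp_all
  then show "\<Gamma> @ [(y, B)] \<turnstile>\<^sub>P\<^sub>T\<^sub>S appl (PVar y) l \<^bold>: C"
    using appl_typ[OF l z(2,3), of "\<Gamma> @ [(y, B)]"] by auto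
qed

text \<open>The cut rule: a term of the type of the hole is substituted for it, in a possibly larger
  environment.\<close>

lemma list_typD:
  assumes "list_typ \<Gamma> B l C" and "set \<Gamma> \<subseteq> set \<Delta>" and "\<Delta> \<turnstile>\<^sub>P\<^sub>T\<^sub>S u \<^bold>: B"
  shows "\<Delta> \<turnstile>\<^sub>P\<^sub>T\<^sub>S appl u l \<^bold>: C"
proof -
  obtain z where z: "z \<notin> edom \<Gamma>" "z \<notin> lfv l" "z \<notin> pfv C" using ex_fresh[of "{}"] by blast
  then have "\<Gamma> @ [(z, B)] \<turnstile>\<^sub>P\<^sub>T\<^sub>S appl (PVar z) l \<^bold>: C" using assms(1) unfolding list_typ_def by blast
  then show ?thesis using z(2,3) assms(2,3) by (rule appl_typ)
qed

lemma list_typ_sort: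
  assumes "list_typ \<Gamma> B l C"
  shows "\<exists>s. \<Gamma> \<turnstile>\<^sub>P\<^sub>T\<^sub>S B \<^bold>: PSort s"
proof -
  obtain z where "z \<notin> edom \<Gamma>" using ex_fresh[of "{}"] by blast
  then show ?thesis using assms pts_wf_snoc(2) pts_typ_wf unfolding list_typ_def by blast
qed

section \<open>Inclusion of environments up to conversion\<close>

lemma env_le_convD:
  assumes "\<Gamma> \<sqsubseteq> \<Delta>" and "\<B>\<^sub>e \<Delta> wf\<^sub>P\<^sub>T\<^sub>S" and "(x, A) \<in> set \<Gamma>"
  shows "\<exists>T. \<B>\<^sub>e \<Delta> \<turnstile>\<^sub>P\<^sub>T\<^sub>S PVar x \<^bold>: T \<and> T \<leftrightarrow>\<^sub>\<beta>\<^sup>* \<B> A"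
proof -
  obtain B where "(x, B) \<in> set \<Delta>" "A \<leftrightarrow>\<^sup>* B"
    using assms(1,3) unfolding env_le_def by blast
  then have "(x, \<B> B) \<in> set (\<B>\<^sub>e \<Delta>)" "\<B> B \<leftrightarrow>\<^sub>\<beta>\<^sup>* \<B> A"
    by (auto simp: set_\<B>\<^sub>e intro: conv_imp_pconv equivclp_sym)
  then show ?thesis using assms(2) p_var by blast
qed

text \<open>Common core of the two explicit substitution rules.\<close>

lemma pts_subst_env:
  assumes P: "\<B>\<^sub>e \<Gamma> \<turnstile>\<^sub>P\<^sub>T\<^sub>S \<B> P \<^bold>: \<B> A"
    and t: "\<B>\<^sub>e (\<Gamma> @ [(x, A)] @ \<Delta>) \<turnstile>\<^sub>P\<^sub>T\<^sub>S t \<^bold>: T"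
    and le: "\<Gamma> @ env_sub P x A \<Delta> \<sqsubseteq> \<Delta>'" and wf: "\<B>\<^sub>e \<Delta>' wf\<^sub>P\<^sub>T\<^sub>S"
  shows "\<B>\<^sub>e \<Delta>' \<turnstile>\<^sub>P\<^sub>T\<^sub>S t{x:=\<B> P} \<^bold>: T{x:=\<B> P}"
proof (rule pts_psub_conv[OF t wf])
  note conv = env_le_convD[OF le wf]
  have wf0: "(\<B>\<^sub>e \<Gamma> @ [(x, \<B> A)] @ \<B>\<^sub>e \<Delta>) wf\<^sub>P\<^sub>T\<^sub>S" using pts_typ_wf[OF t] by simp
  then have wf1: "(\<B>\<^sub>e \<Gamma> @ [(x, \<B> A)]) wf\<^sub>P\<^sub>T\<^sub>S"
    using pts_wf_prefix[of "\<B>\<^sub>e \<Gamma> @ [(x, \<B> A)]"] by simp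
  have x: "x \<notin> edom \<Gamma>" using pts_wf_snoc(1)[OF wf1] by simp
  \<comment> \<open>The identity substitution transports \<open>P\<close> to
    \<open>\<Delta>'\<close>; plain weakening would not do, as the declared types agree only up to
    conversion.\<close>
  have "\<B>\<^sub>e \<Delta>' \<turnstile>\<^sub>P\<^sub>T\<^sub>S psub PVar (\<B> P) \<^bold>: psub PVar (\<B> A)"
  proof (rule pts_psub_conv[OF P wf])
    fix y T assume "(y, T) \<in> set (\<B>\<^sub>e \<Gamma>)"
    then obtain D where "(y, D) \<in> set \<Gamma>" "T = \<B> D" by (auto simp: set_\<B>\<^sub>e)
    then show "\<exists>B. \<B>\<^sub>e \<Delta>' \<turnstile>\<^sub>P\<^sub>T\<^sub>S PVar y \<^bold>: B \<and> B \<leftrightarrow>\<^sub>\<beta>\<^sup>* psub PVar T"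
      using conv[of y D] by simp
  qed
  then have P': "\<B>\<^sub>e \<Delta>' \<turnstile>\<^sub>P\<^sub>T\<^sub>S \<B> P \<^bold>: \<B> A" by simp
  fix y T assume "(y, T) \<in> set (\<B>\<^sub>e (\<Gamma> @ [(x, A)] @ \<Delta>))"
  then consider D where "(y, D) \<in> set \<Gamma>" "T = \<B> D" | "y = x" "T = \<B> A"
    | D where "(y, D) \<in> set \<Delta>" "T = \<B> D"
    by (auto simp: set_\<B>\<^sub>e)
  then show "\<exists>B. \<B>\<^sub>e \<Delta>' \<turnstile>\<^sub>P\<^sub>T\<^sub>S (PVar(x := \<B> P)) y \<^bold>: B \<and> B \<leftrightarrow>\<^sub>\<beta>\<^sup>* T{x:=\<B> P}"
  proof cases
    case 1
    have "(y, \<B> D) \<in> set (\<B>\<^sub>e \<Gamma>)" using 1 by (auto simp: set_\<B>\<^sub>e)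
    then have "x \<notin> pfv (\<B> D)" "y \<noteq> x"
      using pts_wf_pfv[OF pts_wf_prefix[OF wf1], of y "\<B> D"] x 1(1) by force+
    then show ?thesis using conv[of y D] 1 by (simp add: subst_notin)
  next
    case 2
    have "x \<notin> pfv (\<B> A)" using pts_wf_snoc(2)[OF wf1] pts_typ_pfv x by fastforce
    then show ?thesis using P' 2 by (auto simp: subst_notin)
  next
    case 3
    have "x \<notin> edom (\<B>\<^sub>e \<Delta>)" using pts_wf_distinct[OF wf0] by auto
    then have "y \<noteq> x" using 3(1) by force
    \<comment> \<open>Here \<open>D\<close> may mention \<open>x\<close>, and the type stored by
      \<open>env_sub\<close> translates to exactly the substituted type.\<close>
    moreover have "(y, Sub P x A D) \<in> set (env_sub P x A \<Delta>)"
      using 3(1) unfolding env_sub_def by force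
    ultimately show ?thesis using conv[of y "Sub P x A D"] 3(2) by (simp del: \<B>.simps add: \<B>_named)
  qed
qed

lemma pts_preservation:
  shows "\<Gamma> wf \<Longrightarrow> \<B>\<^sub>e \<Gamma> wf\<^sub>P\<^sub>T\<^sub>S"
    and "\<Gamma> \<turnstile> M \<^bold>: A \<Longrightarrow> \<B>\<^sub>e \<Gamma> \<turnstile>\<^sub>P\<^sub>T\<^sub>S \<B> M \<^bold>: \<B> A"
    and "\<Gamma> \<^bold>; B \<turnstile> l \<^bold>: C \<Longrightarrow> list_typ (\<B>\<^sub>e \<Gamma>) (\<B> B) l (\<B> C)"
proof (induction \<Gamma> and \<Gamma> M A and \<Gamma> B l C rule: ptsc_wf_ptsc_typ_ptsc_ltyp.inducts)
  case wf_empty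
  show ?case by (simp add: pwf_empty)
next
  case (wf_extend \<Gamma> A s x)
  then show ?case using pwf_extend[of "\<B>\<^sub>e \<Gamma>" "\<B> A" s x] by simp
next
  case (t_sort \<Gamma> s s')
  then show ?case by (simp add: p_sort)
next
  case (t_Pi \<Gamma> A s1 x B s2 s3)
  then show ?case unfolding \<B>_named using p_Pi[of "\<B>\<^sub>e \<Gamma>" "\<B> A" s1 x "\<B> B" s2 s3] by simp
next
  case (t_Lam \<Gamma> x A B s M)
  have "\<B>\<^sub>e \<Gamma> \<turnstile>\<^sub>P\<^sub>T\<^sub>S PPi x (\<B> A) (\<B> B) \<^bold>: PSort s"
    using t_Lam.IH(2) unfolding \<B>_named by simp
  moreover have "\<B>\<^sub>e \<Gamma> @ [(x, \<B> A)] \<turnstile>\<^sub>P\<^sub>T\<^sub>S \<B> M \<^bold>: \<B> B" using t_Lam.IH(4) by simp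
  ultimately show ?case unfolding \<B>_named by (rule p_Lam)
next
  case (t_var \<Gamma> A l B x)
  \<comment> \<open>The rule has no premise about \<open>\<Gamma>\<close> alone; well-formedness of
    its translation is extracted from the list judgment.\<close>
  obtain s where "\<B>\<^sub>e \<Gamma> \<turnstile>\<^sub>P\<^sub>T\<^sub>S \<B> A \<^bold>: PSort s" using list_typ_sort[OF t_var.IH(2)] by blast
  then have "\<B>\<^sub>e \<Gamma> \<turnstile>\<^sub>P\<^sub>T\<^sub>S PVar x \<^bold>: \<B> A"
    using t_var.hyps pts_typ_wf by (intro p_var) (auto simp: set_\<B>\<^sub>e)
  then show ?case unfolding \<B>_appl by (intro list_typD[OF t_var.IH(2)]) auto
next
  case (t_nil \<Gamma> A s)
  then have "\<B>\<^sub>e \<Gamma> \<turnstile>\<^sub>P\<^sub>T\<^sub>S \<B> A \<^bold>: PSort s" by simp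
  from p_var[OF pwf_extend[OF this]] show ?case by (simp add: list_typ_def)
next
  case (t_conv \<Gamma> M A B s)
  then show ?case using p_conv[OF _ _ conv_imp_pconv] by fastforce
next
  case (t_cons \<Gamma> x A B s M l C)
  have Pi: "\<B>\<^sub>e \<Gamma> \<turnstile>\<^sub>P\<^sub>T\<^sub>S PPi x (\<B> A) (\<B> B) \<^bold>: PSort s"
    using t_cons.IH(2) unfolding \<B>_named by simp
  show ?case unfolding list_typ_def \<B>_named
  proof (intro allI impI)
    fix y assume y: "y \<notin> edom (\<B>\<^sub>e \<Gamma>)"
    let ?\<Delta> = "\<B>\<^sub>e \<Gamma> @ [(y, PPi x (\<B> A) (\<B> B))]"
    have wf: "?\<Delta> wf\<^sub>P\<^sub>T\<^sub>S" using pwf_extend[OF Pi y] .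
    have "?\<Delta> \<turnstile>\<^sub>P\<^sub>T\<^sub>S \<B> M \<^bold>: \<B> A" by (rule pts_weaken[OF t_cons.IH(4) _ wf]) auto
    moreover have "?\<Delta> \<turnstile>\<^sub>P\<^sub>T\<^sub>S PVar y \<^bold>: PPi x (\<B> A) (\<B> B)" using wf by (intro p_var) simp_all
    ultimately have "?\<Delta> \<turnstile>\<^sub>P\<^sub>T\<^sub>S PApp (PVar y) (\<B> M) \<^bold>: (\<B> B){x:=\<B> M}" by (intro p_app)
    then show "?\<Delta> \<turnstile>\<^sub>P\<^sub>T\<^sub>S appl (PVar y) (LCons M l) \<^bold>: \<B> C"
      unfolding appl.simps using t_cons.IH(6) unfolding \<B>_named by (intro list_typD[of "\<B>\<^sub>e \<Gamma>"]) auto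
  qed
next
  case (t_lconv_right \<Gamma> C l A B s)
  show ?case unfolding list_typ_def
  proof (intro allI impI)
    fix y assume "y \<notin> edom (\<B>\<^sub>e \<Gamma>)"
    then have l: "\<B>\<^sub>e \<Gamma> @ [(y, \<B> C)] \<turnstile>\<^sub>P\<^sub>T\<^sub>S appl (PVar y) l \<^bold>: \<B> A"
      using t_lconv_right.IH(2) unfolding list_typ_def by blast
    have "\<B>\<^sub>e \<Gamma> @ [(y, \<B> C)] \<turnstile>\<^sub>P\<^sub>T\<^sub>S \<B> B \<^bold>: PSort s"
      using pts_weaken[OF t_lconv_right.IH(4) _ pts_typ_wf[OF l]] by auto
    from p_conv[OF l this conv_imp_pconv[OF t_lconv_right.hyps(1)]]
    show "\<B>\<^sub>e \<Gamma> @ [(y, \<B> C)] \<turnstile>\<^sub>P\<^sub>T\<^sub>S appl (PVar y) l \<^bold>: \<B> B" .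
  qed
next
  case (t_lconv_left \<Gamma> A l C B s)
  show ?case unfolding list_typ_def
  proof (intro allI impI)
    fix y assume y: "y \<notin> edom (\<B>\<^sub>e \<Gamma>)"
    have B: "\<B>\<^sub>e \<Gamma> \<turnstile>\<^sub>P\<^sub>T\<^sub>S \<B> B \<^bold>: PSort s" using t_lconv_left.IH(4) by simp
    have wf: "(\<B>\<^sub>e \<Gamma> @ [(y, \<B> B)]) wf\<^sub>P\<^sub>T\<^sub>S" using pwf_extend[OF B y] .
    obtain s' where "\<B>\<^sub>e \<Gamma> \<turnstile>\<^sub>P\<^sub>T\<^sub>S \<B> A \<^bold>: PSort s'"
      using list_typ_sort[OF t_lconv_left.IH(2)] by blast
    then have A: "\<B>\<^sub>e \<Gamma> @ [(y, \<B> B)] \<turnstile>\<^sub>P\<^sub>T\<^sub>S \<B> A \<^bold>: PSort s'"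
      by (rule pts_weaken[OF _ _ wf]) auto
    have "\<B>\<^sub>e \<Gamma> @ [(y, \<B> B)] \<turnstile>\<^sub>P\<^sub>T\<^sub>S PVar y \<^bold>: \<B> B" using wf by (intro p_var) simp_all
    \<comment> \<open>The new hole is converted back to the old type \<open>A\<close> and then
      plugged into the given list.\<close>
    from p_conv[OF this A equivclp_sym[OF conv_imp_pconv[OF t_lconv_left.hyps(1)]]]
    show "\<B>\<^sub>e \<Gamma> @ [(y, \<B> B)] \<turnstile>\<^sub>P\<^sub>T\<^sub>S appl (PVar y) l \<^bold>: \<B> C"
      by (intro list_typD[OF t_lconv_left.IH(2)]) auto
  qed
next
  case (t_append \<Gamma> C l' A l B)
  show ?case unfolding list_typ_def
  proof (intro allI impI)
    fix y assume "y \<notin> edom (\<B>\<^sub>e \<Gamma>)"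
    then have "\<B>\<^sub>e \<Gamma> @ [(y, \<B> C)] \<turnstile>\<^sub>P\<^sub>T\<^sub>S appl (PVar y) l' \<^bold>: \<B> A"
      using t_append.IH(2) unfolding list_typ_def by blast
    then show "\<B>\<^sub>e \<Gamma> @ [(y, \<B> C)] \<turnstile>\<^sub>P\<^sub>T\<^sub>S appl (PVar y) (LApp l' l) \<^bold>: \<B> B"
      unfolding appl.simps by (intro list_typD[OF t_append.IH(4)]) auto
  qed
next
  case (t_lsub \<Gamma> P A x \<Delta> B l C \<Delta>')
  show ?case unfolding \<B>_named
  proof (rule list_typI[where X = "insert x (edom \<Gamma> \<union> edom \<Delta>)"])
    fix z assume z: "z \<notin> edom (\<B>\<^sub>e \<Delta>')" "z \<notin> insert x (edom \<Gamma> \<union> edom \<Delta>)"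
    \<comment> \<open>Before the list itself is treated, the substitution lemma is applied to the
      type \<open>B\<close>, so that the target may be extended by the new hole.\<close>
    obtain s where "\<B>\<^sub>e (\<Gamma> @ [(x, A)] @ \<Delta>) \<turnstile>\<^sub>P\<^sub>T\<^sub>S \<B> B \<^bold>: PSort s"
      using list_typ_sort[OF t_lsub.IH(4)] by blast
    from pts_subst_env[OF t_lsub.IH(2) this t_lsub.hyps(1) t_lsub.IH(6)]
    have "\<B>\<^sub>e \<Delta>' \<turnstile>\<^sub>P\<^sub>T\<^sub>S (\<B> B){x:=\<B> P} \<^bold>: PSort s" by simp
    from pwf_extend[OF this z(1)] have wf: "\<B>\<^sub>e (\<Delta>' @ [(z, Sub P x A B)]) wf\<^sub>P\<^sub>T\<^sub>S"
      by (simp add: \<B>_named(5) del: \<B>.simps)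
    \<comment> \<open>The hole is treated as one more entry at the end of \<open>\<Delta>\<close>;
      the list judgment then becomes a term judgment covered by
      \<open>pts_subst_env\<close>.\<close>
    have "\<B>\<^sub>e (\<Gamma> @ [(x, A)] @ (\<Delta> @ [(z, B)])) \<turnstile>\<^sub>P\<^sub>T\<^sub>S appl (PVar z) l \<^bold>: \<B> C"
      using t_lsub.IH(4) z(2) unfolding list_typ_def by (auto simp: image_Un)
    moreover have "\<Gamma> @ env_sub P x A (\<Delta> @ [(z, B)]) \<sqsubseteq> \<Delta>' @ [(z, Sub P x A B)]"
      using t_lsub.hyps(1) unfolding env_le_def env_sub_def by fastforce
    ultimately have "\<B>\<^sub>e (\<Delta>' @ [(z, Sub P x A B)]) \<turnstile>\<^sub>P\<^sub>T\<^sub>S (appl (PVar z) l){x:=\<B> P} \<^bold>: (\<B> C){x:=\<B> P}"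
      using wf by (rule pts_subst_env[OF t_lsub.IH(2)])
    moreover have "(appl (PVar z) l){x:=\<B> P} = appl (PVar z) (LSub P x A l)"
      using z(2) by (subst subst_appl[where A = A]) (simp del: appl.simps)
    ultimately show "\<B>\<^sub>e \<Delta>' @ [(z, (\<B> B){x:=\<B> P})] \<turnstile>\<^sub>P\<^sub>T\<^sub>S
        appl (PVar z) (LSub P x A l) \<^bold>: (\<B> C){x:=\<B> P}"
      by (simp add: \<B>_named(5) del: \<B>.simps appl.simps)
  qed simp
next
  case (t_app \<Gamma> M A l B)
  then show ?case unfolding \<B>_appl by (blast intro: list_typD)
next
  case (t_sub \<Gamma> P A x \<Delta> M C \<Delta>')
  have "\<B>\<^sub>e \<Delta>' \<turnstile>\<^sub>P\<^sub>T\<^sub>S (\<B> M){x:=\<B> P} \<^bold>: (\<B> C){x:=\<B> P}"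
    using t_sub.IH(2,4) t_sub.hyps(1) t_sub.IH(6) by (rule pts_subst_env)
  \<comment> \<open>If \<open>C\<close> is a sort, its translation is fixed by the substitution, so
    both alternatives of the rule yield the same PTS type.\<close>
  then show ?case unfolding \<B>_named by (auto simp: \<B>_ren inst_bind)
qed

end

theorem theorem4p4:
  fixes Ax :: "('s \<times> 's) set"
    and Rl :: "('s \<times> 's \<times> 's) set"
  shows "(\<forall>\<Gamma> M A. pts_spec.ptsc_typ Ax Rl \<Gamma> M A \<longrightarrow>
            pts_spec.pts_typ Ax Rl (\<B>\<^sub>e \<Gamma>) (\<B> M) (\<B> A))
       \<and> (\<forall>\<Gamma> B l C y. pts_spec.ptsc_ltyp Ax Rl \<Gamma> B l C \<longrightarrow> y \<notin> edom \<Gamma> \<longrightarrow>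
            pts_spec.pts_typ Ax Rl (\<B>\<^sub>e \<Gamma> @ [(y, \<B> B)]) (\<B>\<^sub>l y l) (\<B> C))
       \<and> (\<forall>\<Gamma>. pts_spec.ptsc_wf Ax Rl \<Gamma> \<longrightarrow> pts_spec.pts_wf Ax Rl (\<B>\<^sub>e \<Gamma>))"
proof (intro conjI allI impI)
  fix \<Gamma> :: "'s env" and B l C y
  assume "pts_spec.ptsc_ltyp Ax Rl \<Gamma> B l C" and "y \<notin> edom \<Gamma>"
  then show "pts_spec.pts_typ Ax Rl (\<B>\<^sub>e \<Gamma> @ [(y, \<B> B)]) (\<B>\<^sub>l y l) (\<B> C)"
    using pts_spec.pts_preservation(3)[of Ax Rl \<Gamma> B l C]
    unfolding pts_spec.list_typ_def \<B>\<^sub>l_eq_appl \<B>\<^sub>e_simps(4) by blast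
qed (simp_all only: pts_spec.pts_preservation)

end
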